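(* Let $A\in\mathbb{R}^{n\times n}$ be a matrix diagonalizable over $\mathbb{C}$. Then there exists an integer $s>n$ and a generic cut-and-project scheme $\Lambda=(\mathcal{L}\subset\mathbb{R}^s,\mathbb{R}^n)$ such that $A$ is a self-similarity of $\Lambda$ if and only if every eigenvalue of $A$ is an algebraic integer.
   Context: A lattice $\mathcal{L}\subset\mathbb{R}^s$ is a set $\{L\mathbf{r}:\mathbf{r}\in\mathbb{Z}^s\}$ for a non-singular $L\in\mathbb{R}^{s\times s}$, called a matrix associated to $\mathcal{L}$. For $1\le n<s$, the cut-and-project scheme $\Lambda=(\mathcal{L}\subset\mathbb{R}^s,\mathbb{R}^n)$ consists of $\mathcal{L}$ together with the projections $\pi_\parallel(\mathbf{x})=(x_1,\dots,x_n)^\top\in\mathbb{R}^n$ and $\pi_\perp(\mathbf{x})=(x_{n+1},\dots,x_s)^\top\in\mathbb{R}^{s-n}$. The scheme is non-degenerate if $\pi_\parallel$ restricted to $\mathcal{L}$ is injective, aperiodic if $\pi_\perp$ restricted to $\mathcal{L}$ is injective, irreducible if $\pi_\perp(\mathcal{L})$ is dense in $\mathbb{R}^{s-n}$, and generic if all three hold. A linear map (matrix) $A\in\mathbb{R}^{n\times n}$ is a self-similarity of a generic scheme $\Lambda$ with associated matrix $L$ if $A\pi_\parallel(\mathcal{L})\subset\pi_\parallel(\mathcal{L})$ and there exist $C\in\mathbb{Z}^{s\times s}$ and $B\in\mathbb{R}^{(s-n)\times(s-n)}$ with $\begin{pmatrix}A&O\\O&B\end{pmatrix}L=LC$. *)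

theory Defs
  imports "Jordan_Normal_Form.Char_Poly" "Jordan_Normal_Form.Determinant"
    "HOL-Computational_Algebra.Polynomial"
begin

definition diagonalizable_over_C :: "nat \<Rightarrow> real mat \<Rightarrow> bool" where
  "diagonalizable_over_C n A \<longleftrightarrow> A \<in> carrier_mat n n \<and>
     (\<exists>D :: complex mat. D \<in> carrier_mat n n \<and> diagonal_mat D \<and>
        similar_mat (map_mat complex_of_real A) D)"

definition int_vecs :: "nat \<Rightarrow> real vec set" where
  "int_vecs s = {r. r \<in> carrier_vec s \<and> (\<forall>i<s. r $ i \<in> \<int>)}"

definition lattice_of :: "real mat \<Rightarrow> real vec set" where
  "lattice_of L = (\<lambda>r. L *\<^sub>v r) ` int_vecs (dim_col L)"

definition pi_par :: "nat \<Rightarrow> real vec \<Rightarrow> real vec" where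
  "pi_par n x = vec n (\<lambda>i. x $ i)"

definition pi_perp :: "nat \<Rightarrow> nat \<Rightarrow> real vec \<Rightarrow> real vec" where
  "pi_perp s n x = vec (s - n) (\<lambda>i. x $ (n + i))"

definition cut_and_project :: "nat \<Rightarrow> nat \<Rightarrow> real mat \<Rightarrow> bool" where
  "cut_and_project s n L \<longleftrightarrow> L \<in> carrier_mat s s \<and> det L \<noteq> 0 \<and> 1 \<le> n \<and> n < s"

definition non_degenerate :: "nat \<Rightarrow> nat \<Rightarrow> real mat \<Rightarrow> bool" where
  "non_degenerate s n L \<longleftrightarrow> inj_on (pi_par n) (lattice_of L)"

definition aperiodic :: "nat \<Rightarrow> nat \<Rightarrow> real mat \<Rightarrow> bool" where
  "aperiodic s n L \<longleftrightarrow> inj_on (pi_perp s n) (lattice_of L)"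

text \<open>Density of the projected lattice in R^(s-n) (Euclidean topology, expressed via
  coordinatewise approximation, which induces the same topology).\<close>
definition irreducible_cps :: "nat \<Rightarrow> nat \<Rightarrow> real mat \<Rightarrow> bool" where
  "irreducible_cps s n L \<longleftrightarrow>
     (\<forall>y \<in> carrier_vec (s - n). \<forall>e > 0. \<exists>x \<in> lattice_of L.
        \<forall>i < s - n. \<bar>pi_perp s n x $ i - y $ i\<bar> < e)"

definition generic_cps :: "nat \<Rightarrow> nat \<Rightarrow> real mat \<Rightarrow> bool" where
  "generic_cps s n L \<longleftrightarrow> cut_and_project s n L \<and> non_degenerate s n L \<and>
     aperiodic s n L \<and> irreducible_cps s n L"

definition self_similarity :: "nat \<Rightarrow> nat \<Rightarrow> real mat \<Rightarrow> real mat \<Rightarrow> bool" where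
  "self_similarity s n L A \<longleftrightarrow> A \<in> carrier_mat n n \<and>
     (\<lambda>v. A *\<^sub>v v) ` (pi_par n ` lattice_of L) \<subseteq> pi_par n ` lattice_of L \<and>
     (\<exists>C B. C \<in> carrier_mat s s \<and> (\<forall>i<s. \<forall>j<s. C $$ (i, j) \<in> \<int>) \<and>
        B \<in> carrier_mat (s - n) (s - n) \<and>
        four_block_mat A (0\<^sub>m n (s - n)) (0\<^sub>m (s - n) n) B * L = L * C)"

end

theory Submission
  imports "HOL-Analysis.Kronecker_Approximation_Theorem" Defs
begin

text \<open>If \<open>A\<close> is a self-similarity, the block matrix \<open>diag(A, B)\<close> is similar to an integer matrix,
  so its characteristic polynomial is monic with integer coefficients.

  Conversely, let \<open>p\<close> be the integer polynomial of least degree vanishing at all eigenvalues of \<open>A\<close>;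
  by Gauss's lemma it is monic, and by minimality all eigenvalues are simple roots, so that \<open>p(A) = 0\<close>
  and \<open>p'(A)\<close> is invertible, while \<open>q(A) \<noteq> 0\<close> for every nonzero integer polynomial \<open>q\<close> of smaller degree.
  With \<open>d = deg p\<close> and \<open>s = d (n + 1)\<close>, let \<open>C\<close> be the sum of \<open>n + 1\<close> companion matrices of \<open>p\<close>.
  For \<open>U\<close> of size \<open>n \<times> (n + 1)\<close> and \<open>W\<close> of size \<open>(n + 1) \<times> n\<close> with \<open>U W = 1\<close>, the matrices \<open>M\<close> with blocks
  \<open>A^(d-1-k) U\<close> and \<open>J\<close> with blocks \<open>W g_k(A)\<close>, where the \<open>g_k\<close> are the Horner polynomials of \<open>p\<close>, satisfy
  \<open>A M = M C\<close>, \<open>C J = J A\<close> and \<open>M J = p'(A)\<close>. Hence \<open>\<real>^s\<close> is the direct sum of the \<open>C\<close>-invariant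
  subspaces \<open>ker M\<close> and \<open>im J\<close>, and in adapted coordinates \<open>\<int>^s\<close> becomes the required lattice once
  both subspaces meet \<open>\<int>^s\<close> trivially and some \<open>J x\<close> has rationally independent entries; the latter
  gives density by Kronecker's theorem. All these conditions hold for generic \<open>U\<close>, \<open>W\<close> and \<open>x\<close>, because each of the
  countably many integer vectors excludes only the zeros of a nonzero polynomial.\<close>

unbundle no vec_syntax
hide_const (open) module.smult

section \<open>Generic real parameters and Kronecker approximation\<close>

text \<open>Each nonzero polynomial has finitely many roots, so countably many of them cannot cover
  the uncountable real line. All genericity arguments below reduce to this.\<close>

lemma nonroot_of_countable_polys:
  fixes S :: "real poly set"
  assumes "countable S" "0 \<notin> S"
  obtains t where "\<And>p. p \<in> S \<Longrightarrow> poly p t \<noteq> 0"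
proof -
  have "countable (\<Union>p\<in>S. {t. poly p t = 0})"
    by (rule countable_UN[OF assms(1)], rule countable_finite, rule poly_roots_finite) (use assms(2) in auto)
  then have "(\<Union>p\<in>S. {t. poly p t = 0}) \<noteq> UNIV"
    using uncountable_UNIV_real by metis
  then show ?thesis using that by blast
qed

text \<open>On the moment curve \<open>v j = t ^ j\<close> a linear form becomes a polynomial in
  \<open>t\<close> with the same coefficients, so one real \<open>t\<close> serves all forms.
  Dividing by \<open>t ^ e\<close> normalizes one coordinate, which can then carry the constant term
  of an affine expression.\<close>

lemma nonvanishing_of_countable_forms:
  fixes f :: "'i :: countable \<Rightarrow> nat \<Rightarrow> real"
  assumes "e < m"
  obtains v :: "nat \<Rightarrow> real" where "v e = 1"
    and "\<And>i k. k < m \<Longrightarrow> f i k \<noteq> 0 \<Longrightarrow> (\<Sum>j<m. f i j * v j) \<noteq> 0"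
proof -
  define P where "P i = (\<Sum>j<m. monom (f i j) j)" for i
  have coeffP: "coeff (P i) k = (if k < m then f i k else 0)" for i k
    unfolding P_def coeff_sum by (simp add: sum.delta')
  \<comment> \<open>The polynomial \<open>[:0, 1:]\<close> joins the family so that \<open>t\<close>
    is nonzero.\<close>
  define S where "S = insert [:0, 1:] (P ` {i. \<exists>k<m. f i k \<noteq> 0})"
  have "countable S" unfolding S_def by simp
  moreover have "P i \<noteq> 0" if "k < m" "f i k \<noteq> 0" for i k
    using coeffP[of i k] that by auto
  then have "0 \<notin> S" unfolding S_def by auto
  ultimately obtain t where t: "\<And>p. p \<in> S \<Longrightarrow> poly p t \<noteq> 0"
    using nonroot_of_countable_polys by blast
  have t0: "t \<noteq> 0" using t[of "[:0, 1:]"] by (simp add: S_def)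
  show ?thesis
  proof (rule that[of "\<lambda>j. t ^ j / t ^ e"])
    show "t ^ e / t ^ e = 1" using t0 by simp
    fix i k assume "k < m" "f i k \<noteq> 0"
    then have "poly (P i) t \<noteq> 0" using t[of "P i"] by (auto simp: S_def)
    moreover have "(\<Sum>j<m. f i j * (t ^ j / t ^ e)) = poly (P i) t / t ^ e"
      unfolding P_def poly_sum poly_monom by (simp add: sum_divide_distrib)
    ultimately show "(\<Sum>j<m. f i j * (t ^ j / t ^ e)) \<noteq> 0" using t0 by simp
  qed
qed

text \<open>Kronecker's theorem with independence phrased through integer relations of an indexed
  family. \<open>Kronecker_thm_1\<close> speaks of the set of values, so injectivity of
  \<open>\<theta>\<close> is derived separately: equal values would give a relation with
  coefficients 1 and -1.\<close>

lemma Kronecker_approx: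
  fixes \<alpha> \<theta> :: "nat \<Rightarrow> real"
  assumes indep: "\<And>r :: nat \<Rightarrow> int. (\<Sum>i<m. of_int (r i) * \<theta> i) = 0 \<Longrightarrow> \<forall>i<m. r i = 0"
    and "\<epsilon> > 0"
  obtains t h where "\<And>i. i < m \<Longrightarrow> \<bar>t * \<theta> i - of_int (h i) - \<alpha> i\<bar> < \<epsilon>"
proof -
  \<comment> \<open>The reals as a module over the integers, the setting of
    \<open>independent\<close>.\<close>
  interpret Modules.module "(\<lambda>r. (*) (real_of_int r))"
    by (simp add: Modules.module.intro distrib_left mult.commute)
  have inj: "inj_on \<theta> {..<m}"
  proof (rule inj_onI, rule ccontr)
    fix a b assume ab: "a \<in> {..<m}" "b \<in> {..<m}" "\<theta> a = \<theta> b" "a \<noteq> b"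
    define r :: "nat \<Rightarrow> int" where "r = (\<lambda>i. if i = a then 1 else if i = b then -1 else 0)"
    have "(\<Sum>i<m. of_int (r i) * \<theta> i) = (\<Sum>i\<in>{a,b}. of_int (r i) * \<theta> i)"
      by (rule sum.mono_neutral_right) (use ab in \<open>auto simp: r_def\<close>)
    also have "\<dots> = 0" using ab by (simp add: r_def)
    finally have "r a = 0" using indep ab by blast
    then show False by (simp add: r_def)
  qed
  have "independent (\<theta> ` {..<m})"
  proof (rule ccontr)
    assume "\<not> independent (\<theta> ` {..<m})"
    then obtain u v where uv: "(\<Sum>x\<in>\<theta> ` {..<m}. of_int (u x) * x) = 0" "v \<in> \<theta> ` {..<m}" "u v \<noteq> 0"
      using dependent_finite[of "\<theta> ` {..<m}"] by auto
    have "(\<Sum>i<m. of_int (u (\<theta> i)) * \<theta> i) = 0"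
      using uv(1) by (simp add: sum.reindex[OF inj])
    then show False using indep[of "\<lambda>i. u (\<theta> i)"] uv by auto
  qed
  then show ?thesis
    using Kronecker_thm_1[of \<theta> m \<epsilon> \<alpha>] inj \<open>\<epsilon> > 0\<close> that by blast
qed

section \<open>Minimal integer polynomials\<close>

text \<open>The pseudo-remainder of \<open>q\<close> by \<open>p\<close> vanishes on
  \<open>\<Lambda>\<close> and is zero or of smaller degree, so minimality makes it zero. Staying
  over the integers costs the scalar \<open>a\<close>.\<close>

lemma minimal_int_poly_dvd:
  fixes p q :: "int poly" and \<Lambda> :: "complex set"
  assumes "p \<noteq> 0" and p: "\<And>x. x \<in> \<Lambda> \<Longrightarrow> poly (of_int_poly p) x = 0"
    and min: "\<And>r :: int poly. r \<noteq> 0 \<Longrightarrow> degree r < degree p \<Longrightarrow> \<exists>x\<in>\<Lambda>. poly (of_int_poly r) x \<noteq> 0"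
    and q: "\<And>x. x \<in> \<Lambda> \<Longrightarrow> poly (of_int_poly q) x = 0"
  obtains a h where "a \<noteq> 0" "smult a q = p * h"
proof -
  obtain a h where ah: "a \<noteq> 0" "smult a q = p * h + pseudo_mod q p"
    using pseudo_mod(1)[OF \<open>p \<noteq> 0\<close>] by blast
  have "poly (of_int_poly (pseudo_mod q p)) x = 0" if "x \<in> \<Lambda>" for x
  proof -
    have "pseudo_mod q p = smult a q - p * h" using ah by simp
    then show ?thesis using p[OF that] q[OF that] by (simp add: of_int_poly_hom.hom_minus of_int_poly_hom.hom_mult hom_distribs)
  qed
  then have "pseudo_mod q p = 0"
    using pseudo_mod(2)[OF \<open>p \<noteq> 0\<close>] min by blast
  then show ?thesis using ah that by simp
qed

lemma exists_minimal_int_poly: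
  fixes \<Lambda> :: "complex set" and q :: "int poly"
  assumes "q \<noteq> 0" "\<And>x. x \<in> \<Lambda> \<Longrightarrow> poly (of_int_poly q) x = 0"
  obtains p :: "int poly" where "p \<noteq> 0" "\<And>x. x \<in> \<Lambda> \<Longrightarrow> poly (of_int_poly p) x = 0"
    and "\<And>r :: int poly. r \<noteq> 0 \<Longrightarrow> degree r < degree p \<Longrightarrow> \<exists>x\<in>\<Lambda>. poly (of_int_poly r) x \<noteq> 0"
proof -
  define p where "p = (ARG_MIN degree p. p \<noteq> 0 \<and> (\<forall>x\<in>\<Lambda>. poly (of_int_poly p) x = 0))"
  have "(p \<noteq> 0 \<and> (\<forall>x\<in>\<Lambda>. poly (of_int_poly p) x = 0)) \<and>
    (\<forall>r. r \<noteq> 0 \<and> (\<forall>x\<in>\<Lambda>. poly (of_int_poly r) x = 0) \<longrightarrow> degree p \<le> degree r)"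
    unfolding p_def by (rule arg_min_nat_lemma[where k = q]) (use assms in auto)
  then show ?thesis using that[of p] by (meson not_le)
qed

lemma algebraic_ints_common_poly:
  fixes \<Lambda> :: "complex set"
  assumes "finite \<Lambda>" "\<And>x. x \<in> \<Lambda> \<Longrightarrow> algebraic_int x"
  obtains p :: "int poly" where "lead_coeff p = 1" "\<And>x. x \<in> \<Lambda> \<Longrightarrow> poly (of_int_poly p) x = 0"
proof -
  have "\<forall>x\<in>\<Lambda>. \<exists>p :: int poly. poly (of_int_poly p) x = 0 \<and> lead_coeff p = 1"
    using assms(2) by (simp add: algebraic_int_altdef_ipoly)
  then obtain f :: "complex \<Rightarrow> int poly" where
    f: "\<And>x. x \<in> \<Lambda> \<Longrightarrow> poly (of_int_poly (f x)) x = 0 \<and> lead_coeff (f x) = 1" by metis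
  show ?thesis
  proof (rule that[of "prod f \<Lambda>"])
    show "lead_coeff (prod f \<Lambda>) = 1" using f by (simp add: lead_coeff_prod)
    fix x assume "x \<in> \<Lambda>"
    then have "f x dvd prod f \<Lambda>" using assms(1) by (rule dvd_prodI[rotated])
    then obtain h where "prod f \<Lambda> = f x * h" by blast
    then show "poly (of_int_poly (prod f \<Lambda>)) x = 0" using f[OF \<open>x \<in> \<Lambda>\<close>] by (simp add: hom_distribs)
  qed
qed

text \<open>A primitive polynomial of least degree divides a monic common polynomial over the
  integers, hence has leading coefficient 1 or -1. A root shared with the derivative would allow a
  factor to be removed without losing any root in \<open>\<Lambda>\<close>.\<close>

lemma minimal_monic_int_poly:
  fixes \<Lambda> :: "complex set"
  assumes "finite \<Lambda>" "\<Lambda> \<noteq> {}" "\<And>x. x \<in> \<Lambda> \<Longrightarrow> algebraic_int x"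
  obtains p :: "int poly" where "lead_coeff p = 1" "degree p > 0"
    and "\<And>x. x \<in> \<Lambda> \<Longrightarrow> poly (of_int_poly p) x = 0"
    and "\<And>r :: int poly. r \<noteq> 0 \<Longrightarrow> degree r < degree p \<Longrightarrow> \<exists>x\<in>\<Lambda>. poly (of_int_poly r) x \<noteq> 0"
    and "\<And>x. x \<in> \<Lambda> \<Longrightarrow> poly (of_int_poly (pderiv p)) x \<noteq> 0"
proof -
  obtain P :: "int poly" where P: "lead_coeff P = 1" "\<And>x. x \<in> \<Lambda> \<Longrightarrow> poly (of_int_poly P) x = 0"
    using algebraic_ints_common_poly[OF assms(1,3)] by blast
  then have "P \<noteq> 0" by auto
  obtain p0 :: "int poly" where p0: "p0 \<noteq> 0" "\<And>x. x \<in> \<Lambda> \<Longrightarrow> poly (of_int_poly p0) x = 0"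
    and min0: "\<And>r :: int poly. r \<noteq> 0 \<Longrightarrow> degree r < degree p0 \<Longrightarrow> \<exists>x\<in>\<Lambda>. poly (of_int_poly r) x \<noteq> 0"
    using exists_minimal_int_poly[OF \<open>P \<noteq> 0\<close> P(2)] by blast
  \<comment> \<open>The primitive part keeps degree and roots and prepares for Gauss's
    lemma.\<close>
  define p1 where "p1 = primitive_part p0"
  have p01: "p0 = smult (content p0) p1" "content p0 \<noteq> 0" "p1 \<noteq> 0" "content p1 = 1"
    using p0(1) by (auto simp: p1_def)
  then have deg1: "degree p1 = degree p0" by (metis degree_smult_eq)
  have root1: "poly (of_int_poly p1) x = 0" if "x \<in> \<Lambda>" for x
    using p0(2)[OF that] p01(2) by (subst (asm) p01(1)) (simp add: hom_distribs)
  have min1: "\<exists>x\<in>\<Lambda>. poly (of_int_poly r) x \<noteq> 0" if "r \<noteq> 0" "degree r < degree p1" for r :: "int poly"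
    using min0 that deg1 by simp
  obtain a h where ah: "a \<noteq> 0" "smult a P = p1 * h"
    using minimal_int_poly_dvd[OF p01(3) root1 min1 P(2)] by blast
  have contP: "content P = 1"
  proof -
    have "content P dvd 1" using content_dvd_coeff[of P "degree P"] P(1) by simp
    then show ?thesis using normalize_content[of P] by (metis is_unit_normalize)
  qed
  \<comment> \<open>Contents multiply, and those of \<open>P\<close> and \<open>p1\<close> are 1, so
    \<open>a\<close> divides \<open>h\<close> and cancels: \<open>p1\<close> divides
    \<open>P\<close> over the integers.\<close>
  have "content (smult a P) = content (p1 * h)" using ah by simp
  then have "content h = normalize a" using contP p01(4) by (simp add: content_mult)
  then have "h = smult \<bar>a\<bar> (primitive_part h)"
    by (metis content_times_primitive_part normalize_int_def)
  then have "h = smult a (smult (sgn a) (primitive_part h))"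
    by (metis abs_sgn mult.commute smult_smult)
  then obtain h' where "h = smult a h'" by blast
  then have "smult a P = smult a (p1 * h')" using ah by simp
  then have Ph: "P = p1 * h'" using ah(1) by (simp add: poly_eq_iff)
  then have "lead_coeff p1 * lead_coeff h' = 1" using P(1) by (simp add: lead_coeff_mult)
  then have lc1: "lead_coeff p1 = 1 \<or> lead_coeff p1 = -1"
    by (metis zmult_eq_1_iff)
  \<comment> \<open>The leading coefficient is 1 or -1, so this makes the polynomial monic.\<close>
  define p where "p = smult (lead_coeff p1) p1"
  have lc: "lead_coeff p = 1" using lc1 by (auto simp: p_def)
  have deg: "degree p = degree p1" using lc1 by (auto simp: p_def)
  have root: "poly (of_int_poly p) x = 0" if "x \<in> \<Lambda>" for x
    using root1[OF that] by (simp add: p_def hom_distribs)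
  have min: "\<exists>x\<in>\<Lambda>. poly (of_int_poly r) x \<noteq> 0" if "r \<noteq> 0" "degree r < degree p" for r :: "int poly"
    using min1 that deg by simp
  have "p \<noteq> 0" using lc by auto
  have degpos: "degree p > 0"
  proof (rule ccontr)
    assume "\<not> degree p > 0"
    then obtain c where "p = [:c:]" by (metis degree_0_id gr0I)
    then have "p = 1" using lc by (simp add: one_pCons)
    then show False using root assms(2) by auto
  qed
  have "poly (of_int_poly (pderiv p)) x \<noteq> 0" if x: "x \<in> \<Lambda>" for x
  proof
    assume dx: "poly (of_int_poly (pderiv p)) x = 0"
    \<comment> \<open>If \<open>x\<close> were a double root, its minimal polynomial \<open>f\<close> would divide \<open>p = f h\<close> (up to a scalar) twice,
      and the cofactor \<open>h\<close> would contradict the minimality of \<open>p\<close>.\<close>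
    obtain f :: "int poly" where f: "f \<noteq> 0" "poly (of_int_poly f) x = 0"
      and minf: "\<And>r :: int poly. r \<noteq> 0 \<Longrightarrow> degree r < degree f \<Longrightarrow> poly (of_int_poly r) x \<noteq> 0"
      using exists_minimal_int_poly[of p "{x}"] \<open>p \<noteq> 0\<close> root[OF x] by auto
    have dvdf: "\<exists>a h. a \<noteq> 0 \<and> smult a q = f * h" if "poly (of_int_poly q) x = 0" for q :: "int poly"
      using minimal_int_poly_dvd[of f "{x}" q] f minf that by (metis singletonD singletonI)
    have degf: "degree f > 0"
    proof (rule ccontr)
      assume "\<not> degree f > 0"
      then obtain c where "f = [:c:]" by (metis degree_0_id gr0I)
      then show False using f by auto
    qed
    then have "pderiv f \<noteq> 0" "degree (pderiv f) < degree f"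
      by (auto simp: pderiv_eq_0_iff degree_pderiv)
    then have df: "poly (of_int_poly (pderiv f)) x \<noteq> 0" using minf by blast
    obtain a h where ah: "a \<noteq> 0" "smult a p = f * h" using dvdf[OF root[OF x]] by blast
    have "h \<noteq> 0" using ah \<open>p \<noteq> 0\<close> by auto
    have "smult a (pderiv p) = f * pderiv h + h * pderiv f"
      using arg_cong[OF ah(2), of pderiv] by (simp add: pderiv_smult pderiv_mult)
    \<comment> \<open>At \<open>x\<close> the term with factor \<open>f\<close> drops out while
      \<open>pderiv f\<close> is nonzero, so \<open>h\<close> must vanish there.\<close>
    from arg_cong[OF this, of "\<lambda>q. poly (of_int_poly q) x"]
    have hx: "poly (of_int_poly h) x = 0" using dx df f(2) by (simp add: hom_distribs)
    obtain b k where bk: "b \<noteq> 0" "smult b h = f * k" using dvdf[OF hx] by blast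
    \<comment> \<open>Where \<open>f\<close> vanishes, \<open>b h = f k\<close> makes
      \<open>h\<close> vanish as well; elsewhere on \<open>\<Lambda>\<close> this follows from
      \<open>f h = a p\<close>.\<close>
    have "poly (of_int_poly h) y = 0" if y: "y \<in> \<Lambda>" for y
    proof -
      have "poly (of_int_poly f) y = 0 \<or> poly (of_int_poly h) y = 0"
        using arg_cong[OF ah(2), of "\<lambda>q. poly (of_int_poly q) y"] root[OF y] by (simp add: hom_distribs)
      then show ?thesis
        using arg_cong[OF bk(2), of "\<lambda>q. poly (of_int_poly q) y"] bk(1) by (auto simp: hom_distribs)
    qed
    moreover have "degree h < degree p"
      using arg_cong[OF ah(2), of degree] ah(1) \<open>h \<noteq> 0\<close> f(1) degf by (simp add: degree_mult_eq)
    ultimately show False using min[OF \<open>h \<noteq> 0\<close>] by blast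
  qed
  then show ?thesis using that[OF lc degpos root min] by blast
qed

section \<open>Evaluating integer polynomials at a diagonalizable matrix\<close>

text \<open>\<open>\<Phi> q\<close> is \<open>q\<close> evaluated at \<open>A\<close>.
  Diagonalization over the complex numbers turns this into evaluation at the eigenvalues
  \<open>lam l\<close>, from which vanishing and invertibility are read off. The construction of the
  scheme works from these laws.\<close>

lemma diagonalizable_poly_calculus:
  fixes A :: "real mat"
  assumes A: "A \<in> carrier_mat n n" and diag: "diagonalizable_over_C n A"
  obtains lam :: "nat \<Rightarrow> complex" and \<Phi> :: "int poly \<Rightarrow> real mat"
  where "\<And>l. l < n \<Longrightarrow> eigenvalue (map_mat complex_of_real A) (lam l)"
    and "\<And>q. \<Phi> q \<in> carrier_mat n n"
    and "\<Phi> 1 = 1\<^sub>m n" and "\<And>q. \<Phi> (pCons 0 q) = A * \<Phi> q"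
    and "\<And>p q. \<Phi> (p * q) = \<Phi> p * \<Phi> q" and "\<And>p q. \<Phi> (p + q) = \<Phi> p + \<Phi> q"
    and "\<And>c q. \<Phi> (smult c q) = of_int c \<cdot>\<^sub>m \<Phi> q"
    and "\<And>q. \<Phi> q = 0\<^sub>m n n \<longleftrightarrow> (\<forall>l<n. poly (of_int_poly q) (lam l) = 0)"
    and "\<And>q. (\<And>l. l < n \<Longrightarrow> poly (of_int_poly q) (lam l) \<noteq> 0) \<Longrightarrow> det (\<Phi> q) \<noteq> 0"
proof -
  define Ac where "Ac = map_mat complex_of_real A"
  have Ac[simp]: "Ac \<in> carrier_mat n n" using A by (simp add: Ac_def)
  obtain D P Q where D: "D \<in> carrier_mat n n" "diagonal_mat D" and sim: "similar_mat_wit Ac D P Q"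
    using diag by (auto simp: diagonalizable_over_C_def Ac_def similar_mat_def)
  note w = similar_mat_witD2[OF Ac sim]
  note [simp] = mult_carrier_mat[of _ n n _ n] left_mult_one_mat[of _ n n] right_mult_one_mat[of _ n n]
    left_mult_zero_mat[of _ n n] right_mult_zero_mat[of _ n n]
  have [simp]: "P \<in> carrier_mat n n" "Q \<in> carrier_mat n n" using w by auto
  define lam where "lam l = D $$ (l,l)" for l
  define \<Delta> where "\<Delta> q = mat_diag n (\<lambda>l. poly (of_int_poly q) (lam l))" for q
  have \<Delta>[simp]: "\<Delta> q \<in> carrier_mat n n" for q by (simp add: \<Delta>_def)
  have D_eq: "D = mat_diag n lam"
    by (rule eq_matI) (use D in \<open>auto simp: lam_def mat_diag_def diagonal_mat_def\<close>)
  \<comment> \<open>The calculus over the complex numbers, conjugated back from diagonal matrices;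
    \<open>\<Phi>\<close> will be its real form.\<close>
  define \<Psi> where "\<Psi> q = P * \<Delta> q * Q" for q
  have \<Psi>[simp]: "\<Psi> q \<in> carrier_mat n n" for q by (simp add: \<Psi>_def)
  have \<Delta>_mult: "\<Delta> (p * q) = \<Delta> p * \<Delta> q" for p q
    by (simp add: \<Delta>_def mat_diag_diag of_int_poly_hom.hom_mult)
  have \<Psi>_mult: "\<Psi> (p * q) = \<Psi> p * \<Psi> q" for p q
  proof -
    have "\<Psi> p * \<Psi> q = P * \<Delta> p * (Q * P) * \<Delta> q * Q"
      unfolding \<Psi>_def by (simp add: assoc_mult_mat[of _ n n _ n _ n])
    then show ?thesis unfolding \<Psi>_def w(2) \<Delta>_mult
      by (simp add: assoc_mult_mat[of _ n n _ n _ n])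
  qed
  have \<Psi>_add: "\<Psi> (p + q) = \<Psi> p + \<Psi> q" for p q
  proof -
    have "\<Delta> (p + q) = \<Delta> p + \<Delta> q"
      by (rule eq_matI) (auto simp: \<Delta>_def mat_diag_def of_int_poly_hom.hom_add)
    then show ?thesis unfolding \<Psi>_def
      by (simp add: mult_add_distrib_mat[of _ n n _ n] add_mult_distrib_mat[of _ n n _ _ n])
  qed
  have \<Psi>_smult: "\<Psi> (smult c q) = of_int c \<cdot>\<^sub>m \<Psi> q" for c q
  proof -
    have "\<Delta> (smult c q) = of_int c \<cdot>\<^sub>m \<Delta> q"
      by (rule eq_matI) (auto simp: \<Delta>_def mat_diag_def hom_distribs)
    then show ?thesis unfolding \<Psi>_def
      by (simp add: mult_smult_distrib[of _ n n _ n] mult_smult_assoc_mat[of _ n n _ n])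
  qed
  have \<Psi>_1: "\<Psi> 1 = 1\<^sub>m n"
  proof -
    have "\<Delta> 1 = 1\<^sub>m n" by (rule eq_matI) (auto simp: \<Delta>_def mat_diag_def)
    then show ?thesis by (simp add: \<Psi>_def w(1))
  qed
  have \<Psi>_X: "\<Psi> [:0, 1:] = Ac"
  proof -
    have "\<Delta> [:0, 1:] = D" by (simp add: \<Delta>_def D_eq)
    then show ?thesis by (simp add: \<Psi>_def w(3))
  qed
  have inj: "X = Y" if "map_mat complex_of_real X = map_mat complex_of_real Y" for X Y
    using that by (simp add: of_real_hom.mat_hom_inj)
  have hom_add: "map_mat complex_of_real (X + Y) = map_mat complex_of_real X + map_mat complex_of_real Y"
    if "X \<in> carrier_mat n n" "Y \<in> carrier_mat n n" for X Y
    using that by (intro eq_matI) auto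
  have hom_smult: "map_mat complex_of_real (of_int c \<cdot>\<^sub>m X) = of_int c \<cdot>\<^sub>m map_mat complex_of_real X" for c X
    by (intro eq_matI) auto
  have hom_0: "map_mat complex_of_real (0\<^sub>m n n) = 0\<^sub>m n n"
    by (intro eq_matI) auto
  \<comment> \<open>Horner's scheme builds a real matrix for each \<open>\<Psi> q\<close>, since
    \<open>A\<close> and the coefficients of \<open>q\<close> are real.\<close>
  have "\<exists>R. R \<in> carrier_mat n n \<and> map_mat complex_of_real R = \<Psi> q" for q
  proof (induction q)
    case 0
    have "\<Delta> 0 = 0\<^sub>m n n" by (rule eq_matI) (auto simp: \<Delta>_def mat_diag_def)
    then have "\<Psi> 0 = map_mat complex_of_real (0\<^sub>m n n)" by (simp add: \<Psi>_def hom_0)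
    then show ?case by (metis zero_carrier_mat)
  next
    case (pCons a q)
    then obtain R where R: "R \<in> carrier_mat n n" "map_mat complex_of_real R = \<Psi> q" by blast
    have "pCons a q = smult a 1 + [:0, 1:] * q" by simp
    then have "\<Psi> (pCons a q) = of_int a \<cdot>\<^sub>m 1\<^sub>m n + Ac * \<Psi> q"
      by (simp only: \<Psi>_add \<Psi>_mult \<Psi>_smult \<Psi>_1 \<Psi>_X)
    also have "\<dots> = map_mat complex_of_real (of_int a \<cdot>\<^sub>m 1\<^sub>m n + A * R)"
      using A R(1) by (simp add: Ac_def hom_add hom_smult of_real_hom.mat_hom_mult[of _ n n _ n]
          of_real_hom.mat_hom_one flip: R(2))
    finally show ?case using A R(1)
      by (intro exI[of _ "of_int a \<cdot>\<^sub>m 1\<^sub>m n + A * R"]) simp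
  qed
  then obtain \<Phi> where \<Phi>: "\<And>q. \<Phi> q \<in> carrier_mat n n" "\<And>q. map_mat complex_of_real (\<Phi> q) = \<Psi> q"
    by metis
  have mult: "\<Phi> (p * q) = \<Phi> p * \<Phi> q" for p q
    by (rule inj) (use \<Phi> in \<open>simp add: \<Psi>_mult of_real_hom.mat_hom_mult[of _ n n _ n]\<close>)
  have X: "\<Phi> [:0, 1:] = A" by (rule inj) (simp add: \<Phi>(2) \<Psi>_X Ac_def)
  show ?thesis
  proof (rule that[of lam \<Phi>])
    fix l assume "l < n"
    have "char_poly Ac = char_poly D"
      using sim by (intro char_poly_similar) (auto simp: similar_mat_def)
    also have "\<dots> = (\<Prod>a\<leftarrow>diag_mat D. [:- a, 1:])"
      using D by (intro char_poly_upper_triangular) (auto simp: diagonal_mat_def)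
    finally have "poly (char_poly Ac) (lam l) = (\<Prod>a\<leftarrow>diag_mat D. lam l - a)"
      by (simp add: poly_prod_list o_def)
    also have "\<dots> = 0" using \<open>l < n\<close> D(1) by (auto simp: prod_list_zero_iff diag_mat_def lam_def)
    finally show "eigenvalue (map_mat complex_of_real A) (lam l)"
      using eigenvalue_root_char_poly[OF Ac] by (simp add: Ac_def)
  next
    show "\<Phi> q \<in> carrier_mat n n" for q by (rule \<Phi>)
    show "\<Phi> 1 = 1\<^sub>m n" by (rule inj) (simp add: \<Phi>(2) \<Psi>_1 of_real_hom.mat_hom_one)
    show "\<Phi> (pCons 0 q) = A * \<Phi> q" for q using mult[of "[:0, 1:]" q] X by simp
    show "\<Phi> (p * q) = \<Phi> p * \<Phi> q" for p q by (rule mult)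
    show "\<Phi> (p + q) = \<Phi> p + \<Phi> q" for p q
      by (rule inj) (use \<Phi> in \<open>simp add: \<Psi>_add hom_add\<close>)
    show "\<Phi> (smult c q) = of_int c \<cdot>\<^sub>m \<Phi> q" for c q
      by (rule inj) (use \<Phi> in \<open>simp add: \<Psi>_smult hom_smult\<close>)
    show "\<Phi> q = 0\<^sub>m n n \<longleftrightarrow> (\<forall>l<n. poly (of_int_poly q) (lam l) = 0)" for q
    proof -
      have "\<Phi> q = 0\<^sub>m n n \<longleftrightarrow> \<Psi> q = 0\<^sub>m n n"
        using inj[of "\<Phi> q" "0\<^sub>m n n"] by (auto simp: hom_0 simp flip: \<Phi>(2))
      also have "\<dots> \<longleftrightarrow> \<Delta> q = 0\<^sub>m n n"
      proof
        assume "\<Psi> q = 0\<^sub>m n n"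
        \<comment> \<open>Conjugating the other way recovers \<open>\<Delta> q\<close>, because
          \<open>Q * P\<close> is the identity.\<close>
        then have "Q * \<Psi> q * P = 0\<^sub>m n n" by simp
        moreover have "Q * \<Psi> q * P = (Q * P) * \<Delta> q * (Q * P)"
          unfolding \<Psi>_def by (simp add: assoc_mult_mat[of _ n n _ n _ n])
        ultimately show "\<Delta> q = 0\<^sub>m n n" by (simp add: w(2))
      qed (simp add: \<Psi>_def)
      also have "\<Delta> q = 0\<^sub>m n n \<longleftrightarrow> (\<forall>l<n. poly (of_int_poly q) (lam l) = 0)"
        by (auto simp: \<Delta>_def mat_diag_def mat_eq_iff)
      finally show ?thesis .
    qed
    show "det (\<Phi> q) \<noteq> 0" if nz: "\<And>l. l < n \<Longrightarrow> poly (of_int_poly q) (lam l) \<noteq> 0" for q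
    proof
      assume "det (\<Phi> q) = 0"
      then have "det (\<Psi> q) = 0" by (metis \<Phi>(2) of_real_hom.hom_det of_real_0)
      moreover have "det (\<Psi> q) = det P * det (\<Delta> q) * det Q"
        unfolding \<Psi>_def by (simp add: det_mult[of _ n])
      moreover have "det P * det Q = 1"
        using w(1) by (metis \<open>P \<in> carrier_mat n n\<close> \<open>Q \<in> carrier_mat n n\<close> det_mult det_one)
      ultimately have "det (\<Delta> q) = 0" by auto
      moreover have "det (\<Delta> q) = prod_list (diag_mat (\<Delta> q))"
        by (rule det_upper_triangular[of _ n]) (auto simp: \<Delta>_def mat_diag_def)
      ultimately show False using nz by (auto simp: prod_list_zero_iff diag_mat_def \<Delta>_def mat_diag_def)
    qed
  qed
qed

section \<open>Schemes from invariant complements\<close>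

lemma det_nonzero_inverse:
  fixes A :: "'a :: field mat"
  assumes "A \<in> carrier_mat n n" "det A \<noteq> 0"
  obtains B where "B \<in> carrier_mat n n" "A * B = 1\<^sub>m n" "B * A = 1\<^sub>m n"
  using det_non_zero_imp_unit[OF assms, of undefined] that
  by (auto simp: Units_def ring_mat_def)

text \<open>\<open>K\<close> is \<open>(- J2 X | 1)\<close> with \<open>J2\<close> the lower part of
  \<open>J\<close> and \<open>X\<close> the inverse of the upper part: the lower rows of
  \<open>J\<close> are combinations of the upper ones. The kernel of \<open>K\<close> is the image
  of \<open>J\<close>, and the identity block gives an explicit right inverse.\<close>

lemma annihilator_rows:
  fixes J :: "real mat"
  assumes J: "J \<in> carrier_mat s n" and "n < s"
    and X: "X \<in> carrier_mat n n" and JX: "mat n n (($$) J) * X = 1\<^sub>m n" and XJ: "X * mat n n (($$) J) = 1\<^sub>m n"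
  obtains K where "K \<in> carrier_mat (s - n) s" "K * J = 0\<^sub>m (s - n) n"
    and "\<And>i j. i < s - n \<Longrightarrow> j < s - n \<Longrightarrow> K $$ (i, n + j) = (if i = j then 1 else 0)"
proof -
  define J1 J2 where "J1 = mat n n (($$) J)" and "J2 = mat (s - n) n (\<lambda>(i,j). J $$ (n + i, j))"
  define Y where "Y = J2 * X"
  have Y: "Y \<in> carrier_mat (s - n) n" using X by (auto simp: Y_def J2_def)
  have YJ1: "Y * J1 = J2"
  proof -
    have "Y * J1 = J2 * (X * J1)" unfolding Y_def
      by (rule assoc_mult_mat[of _ "s - n" n _ n _ n]) (use X in \<open>auto simp: J1_def J2_def\<close>)
    then show ?thesis by (simp add: XJ J1_def J2_def)
  qed
  define K where "K = mat (s - n) s (\<lambda>(i,c). if c < n then - Y $$ (i,c) else if c = n + i then 1 else 0)"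
  have "K * J = 0\<^sub>m (s - n) n"
  proof (rule eq_matI)
    fix i j assume "i < dim_row (0\<^sub>m (s - n) n :: real mat)" "j < dim_col (0\<^sub>m (s - n) n :: real mat)"
    then have ij: "i < s - n" "j < n" by auto
    have "(K * J) $$ (i,j) = (\<Sum>c\<in>{0..<n} \<union> {n..<s}. K $$ (i,c) * J $$ (c,j))"
      using ij J \<open>n < s\<close> by (auto simp: K_def scalar_prod_def ivl_disj_un intro!: sum.cong)
    also have "\<dots> = (\<Sum>c=0..<n. K $$ (i,c) * J $$ (c,j)) + (\<Sum>c=n..<s. K $$ (i,c) * J $$ (c,j))"
      by (rule sum.union_disjoint) auto
    also have "(\<Sum>c=0..<n. K $$ (i,c) * J $$ (c,j)) = - (Y * J1) $$ (i,j)"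
      using ij Y \<open>n < s\<close> by (auto simp: K_def J1_def scalar_prod_def sum_negf intro!: sum.cong)
    also have "(\<Sum>c=n..<s. K $$ (i,c) * J $$ (c,j)) = (\<Sum>c=n..<s. if c = n + i then J $$ (c,j) else 0)"
      using ij by (intro sum.cong) (auto simp: K_def)
    also have "\<dots> = J2 $$ (i,j)" using ij by (simp add: J2_def)
    finally show "(K * J) $$ (i,j) = 0\<^sub>m (s - n) n $$ (i,j)" using ij by (simp add: YJ1)
  qed (use J in \<open>auto simp: K_def\<close>)
  moreover have "K $$ (i, n + j) = (if i = j then 1 else 0)" if "i < s - n" "j < s - n" for i j
    using that by (auto simp: K_def)
  ultimately show ?thesis using that[of K] by (simp add: K_def)
qed

text \<open>Stacking \<open>M\<close> on \<open>K\<close> gives coordinates adapted to the sum of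
  the kernel of \<open>M\<close> and the image of \<open>J\<close>: on the lattice,
  \<open>pi_par\<close> is \<open>M\<close> and \<open>pi_perp\<close> is \<open>K\<close>. Both are
  injective because these two subspaces contain no nonzero integer vector, and density is
  Kronecker's theorem for the direction \<open>J x\<close>.\<close>

lemma generic_scheme_exists:
  fixes A M J C :: "real mat"
  assumes n: "1 \<le> n" "n < s"
    and A: "A \<in> carrier_mat n n" and M: "M \<in> carrier_mat n s" and J: "J \<in> carrier_mat s n"
    and C: "C \<in> carrier_mat s s" and C_int: "\<And>i j. i < s \<Longrightarrow> j < s \<Longrightarrow> C $$ (i,j) \<in> \<int>"
    and AM: "A * M = M * C" and CJ: "C * J = J * A"
    and detMJ: "det (M * J) \<noteq> 0" and detJ: "det (mat n n (($$) J)) \<noteq> 0"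
    and M_inj: "\<And>r. r \<in> int_vecs s \<Longrightarrow> M *\<^sub>v r = 0\<^sub>v n \<Longrightarrow> r = 0\<^sub>v s"
    and J_int: "\<And>y. y \<in> carrier_vec n \<Longrightarrow> J *\<^sub>v y \<in> int_vecs s \<Longrightarrow> J *\<^sub>v y = 0\<^sub>v s"
    and x: "x \<in> carrier_vec n" and indep: "\<And>r. r \<in> int_vecs s \<Longrightarrow> r \<bullet> (J *\<^sub>v x) = 0 \<Longrightarrow> r = 0\<^sub>v s"
  shows "\<exists>L. generic_cps s n L \<and> self_similarity s n L A"
proof -
  define m where "m = s - n"
  have s_eq: "s = n + m" using n by (simp add: m_def)
  note [simp] = A M J C carrier_matD[OF M] carrier_matD[OF J] carrier_matD[OF C] carrier_matD[OF A]
  define J1 where "J1 = mat n n (($$) J)"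
  have [simp]: "J1 \<in> carrier_mat n n" by (simp add: J1_def)
  obtain X where X[simp]: "X \<in> carrier_mat n n" and JX: "J1 * X = 1\<^sub>m n" and XJ: "X * J1 = 1\<^sub>m n"
    using det_nonzero_inverse[of J1 n] detJ by (auto simp: J1_def)
  obtain K where K[simp]: "K \<in> carrier_mat m s" and KJ: "K * J = 0\<^sub>m m n"
    and K1: "\<And>i j. i < m \<Longrightarrow> j < m \<Longrightarrow> K $$ (i, n + j) = (if i = j then 1 else 0)"
    using annihilator_rows[OF J n(2) X] JX XJ unfolding J1_def m_def by metis
  note [simp] = carrier_matD[OF K]
  have KJv: "K *\<^sub>v (J *\<^sub>v y) = 0\<^sub>v m" if "y \<in> carrier_vec n" for y
  proof -
    have "K *\<^sub>v (J *\<^sub>v y) = (K * J) *\<^sub>v y" using assoc_mult_mat_vec[OF K J that] by simp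
    then show ?thesis using that by (auto simp: KJ)
  qed
  define L where "L = mat s s (\<lambda>(i,j). if i < n then M $$ (i,j) else K $$ (i - n, j))"
  have L[simp]: "L \<in> carrier_mat s s" by (simp add: L_def)
  note [simp] = carrier_matD[OF L]
  have rowL: "row L i = (if i < n then row M i else row K (i - n))" if "i < s" for i
    using that by (intro eq_vecI) (auto simp: L_def s_eq)
  have LR: "(L * R) $$ (i,j) = (if i < n then (M * R) $$ (i,j) else (K * R) $$ (i - n, j))"
    if "R \<in> carrier_mat s k" "i < s" "j < k" for R k i j
    using that rowL[OF that(2)] by (auto simp: s_eq)
  have par: "pi_par n (L *\<^sub>v r) = M *\<^sub>v r" if "r \<in> carrier_vec s" for r
    using that rowL by (intro eq_vecI) (auto simp: pi_par_def s_eq)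
  have perp: "pi_perp s n (L *\<^sub>v r) = K *\<^sub>v r" if "r \<in> carrier_vec s" for r
    using that rowL by (intro eq_vecI) (auto simp: pi_perp_def s_eq)
  have lattice: "lattice_of L = (\<lambda>r. L *\<^sub>v r) ` int_vecs s"
    by (simp add: lattice_of_def)
  have int_carrier: "r \<in> carrier_vec s" if "r \<in> int_vecs s" for r
    using that by (simp add: int_vecs_def)
  have int_diff: "r - r' \<in> int_vecs s" if "r \<in> int_vecs s" "r' \<in> int_vecs s" for r r'
    using that by (auto simp: int_vecs_def)
  have detL: "det L \<noteq> 0"
  proof -
    \<comment> \<open>The columns of \<open>J\<close> followed by the last unit vectors:
      \<open>L * T\<close> becomes block triangular with diagonal blocks \<open>M * J\<close> and
      the identity, so \<open>det L\<close> cannot vanish.\<close>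
    define T where "T = mat s s (\<lambda>(i,j). if j < n then J $$ (i,j) else if i = j then 1 else 0)"
    have T: "T \<in> carrier_mat s s" by (simp add: T_def)
    have colT: "col T j = (if j < n then col J j else unit_vec s j)" if "j < s" for j
      using that by (intro eq_vecI) (auto simp: T_def)
    have MT: "(M * T) $$ (i,j) = (if j < n then (M * J) $$ (i,j) else M $$ (i,j))" if "i < n" "j < s" for i j
      using that colT[of j] T by auto
    have KT: "(K * T) $$ (i,j) = (if j < n then 0 else K $$ (i,j))" if "i < m" "j < s" for i j
    proof -
      have "row K i \<bullet> col J j = (K * J) $$ (i,j)" if "j < n" using \<open>i < m\<close> that by auto
      then show ?thesis using that colT[of j] T by (auto simp: KJ)
    qed
    define R where "R = mat n m (\<lambda>(i,j). M $$ (i, n + j))"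
    have "L * T = four_block_mat (M * J) R (0\<^sub>m m n) (1\<^sub>m m)"
    proof (rule eq_matI)
      show "dim_row (L * T) = dim_row (four_block_mat (M * J) R (0\<^sub>m m n) (1\<^sub>m m))"
        "dim_col (L * T) = dim_col (four_block_mat (M * J) R (0\<^sub>m m n) (1\<^sub>m m))"
        using M J by (auto simp: L_def T_def s_eq)
      fix i j assume "i < dim_row (four_block_mat (M * J) R (0\<^sub>m m n) (1\<^sub>m m))"
        and "j < dim_col (four_block_mat (M * J) R (0\<^sub>m m n) (1\<^sub>m m))"
      then have ij: "i < s" "j < s" using M J by (auto simp: s_eq)
      show "(L * T) $$ (i,j) = four_block_mat (M * J) R (0\<^sub>m m n) (1\<^sub>m m) $$ (i,j)"
      proof (cases "i < n")
        case True
        then show ?thesis using ij LR[OF T ij] MT[OF True ij(2)] by (auto simp: R_def s_eq)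
      next
        case False
        then have i: "i - n < m" using ij by (auto simp: s_eq)
        then have "j \<ge> n \<Longrightarrow> K $$ (i - n, j) = (if i = j then 1 else 0)"
          using K1[of "i - n" "j - n"] ij False by (auto simp: s_eq)
        then show ?thesis using ij LR[OF T ij] KT[OF i ij(2)] False by (auto simp: s_eq)
      qed
    qed
    then have "det (L * T) = det (M * J) * det (1\<^sub>m m :: real mat)"
      using mult_carrier_mat[OF M J] by (simp add: det_four_block_mat_lower_left_zero[of _ n _ m] R_def)
    then show ?thesis using detMJ det_mult[OF L T] by auto
  qed
  have diff_eq: "v = w" if "v - w = 0\<^sub>v k" "v \<in> carrier_vec k" "w \<in> carrier_vec k" for v w :: "real vec" and k
  proof (rule eq_vecI)
    fix i assume "i < dim_vec w"
    then have i: "i < k" using that(3) by simp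
    then have "(v - w) $ i = 0" by (simp add: that(1))
    then show "v $ i = w $ i" using i that(2,3) by (simp del: that(1))
  qed (use that in auto)
  have L_inj: "v = w" if "v \<in> carrier_vec s" "w \<in> carrier_vec s" "L *\<^sub>v v = L *\<^sub>v w" for v w
  proof -
    have "L *\<^sub>v (v - w) = 0\<^sub>v s"
      using that mult_minus_distrib_mat_vec[OF L that(1,2)] by (intro eq_vecI) auto
    then have "v - w = 0\<^sub>v s"
      using det_0_iff_vec_prod_zero[OF L] detL that by (metis minus_carrier_vec)
    then show ?thesis using diff_eq that by blast
  qed
  have nondeg: "non_degenerate s n L" unfolding non_degenerate_def lattice
  proof (rule inj_onI, clarify)
    fix r r' assume r: "r \<in> int_vecs s" "r' \<in> int_vecs s" "pi_par n (L *\<^sub>v r) = pi_par n (L *\<^sub>v r')"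
    then have rc: "r \<in> carrier_vec s" "r' \<in> carrier_vec s" using int_carrier by auto
    then have "M *\<^sub>v (r - r') = 0\<^sub>v n"
      using r(3) mult_minus_distrib_mat_vec[OF M rc] by (intro eq_vecI) (auto simp: par)
    then have "r - r' = 0\<^sub>v s" using M_inj int_diff r by blast
    then show "L *\<^sub>v r = L *\<^sub>v r'" using diff_eq rc by blast
  qed
  have aper: "aperiodic s n L" unfolding aperiodic_def lattice
  proof (rule inj_onI, clarify)
    fix r r' assume r: "r \<in> int_vecs s" "r' \<in> int_vecs s" "pi_perp s n (L *\<^sub>v r) = pi_perp s n (L *\<^sub>v r')"
    then have rc: "r \<in> carrier_vec s" "r' \<in> carrier_vec s" using int_carrier by auto
    define v where "v = r - r'"
    have v: "v \<in> int_vecs s" "v \<in> carrier_vec s" using int_diff r int_carrier by (auto simp: v_def)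
    have Kv: "K *\<^sub>v v = 0\<^sub>v m"
      using r(3) mult_minus_distrib_mat_vec[OF K rc] rc by (intro eq_vecI) (auto simp: perp v_def)
    obtain Z where Z: "Z \<in> carrier_mat n n" "(M * J) * Z = 1\<^sub>m n"
      using det_nonzero_inverse[of "M * J" n] detMJ mult_carrier_mat[OF M J] by auto
    \<comment> \<open>With this \<open>y\<close>, the vectors \<open>J y\<close> and
      \<open>v\<close> agree under \<open>M\<close>, and both are killed by \<open>K\<close>.
      Injectivity of \<open>L\<close> then makes \<open>v = J y\<close> an integer point in the
      image of \<open>J\<close>.\<close>
    define y where "y = Z *\<^sub>v (M *\<^sub>v v)"
    have y: "y \<in> carrier_vec n" unfolding y_def by (rule mult_mat_vec_carrier[OF Z(1) mult_mat_vec_carrier[OF M v(2)]])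
    have Mv: "M *\<^sub>v v \<in> carrier_vec n" by (rule mult_mat_vec_carrier[OF M v(2)])
    have "M *\<^sub>v (J *\<^sub>v y) = (M * J) *\<^sub>v y" using assoc_mult_mat_vec[OF M J y] by simp
    also have "\<dots> = ((M * J) * Z) *\<^sub>v (M *\<^sub>v v)"
      using assoc_mult_mat_vec[OF mult_carrier_mat[OF M J] Z(1) Mv] by (simp add: y_def)
    finally have MJy: "M *\<^sub>v (J *\<^sub>v y) = M *\<^sub>v v" using Z Mv by simp
    have Jy: "J *\<^sub>v y \<in> carrier_vec s" by (rule mult_mat_vec_carrier[OF J y])
    have "L *\<^sub>v (J *\<^sub>v y) = L *\<^sub>v v"
    proof (rule eq_vecI)
      fix i assume "i < dim_vec (L *\<^sub>v v)"
      then have i: "i < s" by simp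
      have "(L *\<^sub>v w) $ i = (if i < n then (M *\<^sub>v w) $ i else (K *\<^sub>v w) $ (i - n))" for w
        using i rowL[OF i] by (auto simp: s_eq)
      then show "(L *\<^sub>v (J *\<^sub>v y)) $ i = (L *\<^sub>v v) $ i"
        by (simp only: MJy KJv[OF y] Kv)
    qed simp
    then have "J *\<^sub>v y = v" using L_inj Jy v by blast
    then have "v = 0\<^sub>v s" using J_int[OF y] v by simp
    then show "L *\<^sub>v r = L *\<^sub>v r'" using diff_eq rc by (metis v_def)
  qed
  have irred: "irreducible_cps s n L" unfolding irreducible_cps_def lattice m_def[symmetric]
  proof (intro ballI allI impI)
    fix y :: "real vec" and e :: real assume y: "y \<in> carrier_vec m" and e: "e > 0"
    \<comment> \<open>Padding \<open>y\<close> with zeros gives a preimage under \<open>K\<close>,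
      because the right block of \<open>K\<close> is the identity.\<close>
    define w where "w = vec s (\<lambda>c. if c < n then 0 else y $ (c - n))"
    have w: "w \<in> carrier_vec s" by (simp add: w_def)
    have Kw: "(K *\<^sub>v w) $ i = y $ i" if "i < m" for i
    proof -
      have "(K *\<^sub>v w) $ i = (\<Sum>c<s. K $$ (i,c) * w $ c)"
        using that w by (simp add: scalar_prod_def atLeast0LessThan)
      also have "\<dots> = (\<Sum>c<s. if c = n + i then y $ i else 0)"
      proof (rule sum.cong)
        fix c assume "c \<in> {..<s}"
        then show "K $$ (i,c) * w $ c = (if c = n + i then y $ i else 0)"
          using K1[OF that, of "c - n"] by (auto simp: w_def s_eq)
      qed simp
      finally show ?thesis using that by (simp add: s_eq)
    qed
    define \<theta> where "\<theta> i = (J *\<^sub>v x) $ i" for i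
    define S where "S = (\<Sum>i<m. \<Sum>c<s. \<bar>K $$ (i,c)\<bar>)"
    have S: "S \<ge> 0" by (simp add: S_def sum_nonneg)
    \<comment> \<open>\<open>S\<close> bounds every absolute row sum of \<open>K\<close>; the added
      1 keeps the denominator positive and the final estimate strict.\<close>
    define \<epsilon> where "\<epsilon> = e / (1 + S)"
    have \<epsilon>: "\<epsilon> > 0" using e S by (simp add: \<epsilon>_def)
    have "\<forall>i<s. r i = 0" if "(\<Sum>i<s. of_int (r i) * \<theta> i) = 0" for r :: "nat \<Rightarrow> int"
    proof -
      define v where "v = vec s (\<lambda>i. real_of_int (r i))"
      have "v \<in> int_vecs s" by (simp add: v_def int_vecs_def)
      moreover have "v \<bullet> (J *\<^sub>v x) = 0"
        using that by (simp add: v_def scalar_prod_def \<theta>_def atLeast0LessThan)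
      ultimately have "v = 0\<^sub>v s" by (rule indep)
      then have "v $ i = 0" if "i < s" for i using that by simp
      then show ?thesis by (simp add: v_def)
    qed
    \<comment> \<open>The integer vector \<open>h\<close> is close to \<open>t \<theta> + w\<close>.
      Since \<open>K\<close> kills \<open>\<theta> = J x\<close>, its image \<open>K h\<close> is
      close to \<open>K w = y\<close>.\<close>
    then obtain t h where th: "\<And>i. i < s \<Longrightarrow> \<bar>t * \<theta> i - of_int (h i) - (- w $ i)\<bar> < \<epsilon>"
      using Kronecker_approx[where m = s and \<theta> = \<theta> and \<epsilon> = \<epsilon> and \<alpha> = "\<lambda>i. - w $ i"] \<epsilon> by blast
    define r where "r = vec s (\<lambda>i. real_of_int (h i))"
    have r: "r \<in> int_vecs s" "r \<in> carrier_vec s" by (auto simp: r_def int_vecs_def)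
    have "\<bar>(K *\<^sub>v r) $ i - y $ i\<bar> < e" if i: "i < m" for i
    proof -
      have K\<theta>: "(\<Sum>c<s. K $$ (i,c) * \<theta> c) = 0"
        using arg_cong[OF KJv[OF x], of "\<lambda>v. v $ i"] i
        by (simp add: scalar_prod_def \<theta>_def atLeast0LessThan)
      have "y $ i - (K *\<^sub>v r) $ i = (\<Sum>c<s. K $$ (i,c) * w $ c) - (\<Sum>c<s. K $$ (i,c) * of_int (h c))"
        using i w Kw[OF i] by (simp add: scalar_prod_def r_def atLeast0LessThan)
      also have "\<dots> = (\<Sum>c<s. K $$ (i,c) * (t * \<theta> c - of_int (h c) - (- w $ c))) - t * (\<Sum>c<s. K $$ (i,c) * \<theta> c)"
        by (simp add: algebra_simps sum.distrib sum_subtractf sum_distrib_left)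
      finally have "\<bar>y $ i - (K *\<^sub>v r) $ i\<bar> \<le> (\<Sum>c<s. \<bar>K $$ (i,c)\<bar> * \<bar>t * \<theta> c - of_int (h c) - (- w $ c)\<bar>)"
        using sum_abs[of "\<lambda>c. K $$ (i,c) * (t * \<theta> c - of_int (h c) - (- w $ c))" "{..<s}"]
        by (simp add: K\<theta> abs_mult)
      also have "\<dots> \<le> (\<Sum>c<s. \<bar>K $$ (i,c)\<bar> * \<epsilon>)"
        by (intro sum_mono mult_left_mono) (use th in \<open>auto simp: less_imp_le\<close>)
      also have "\<dots> = (\<Sum>c<s. \<bar>K $$ (i,c)\<bar>) * \<epsilon>" by (simp add: sum_distrib_right)
      also have "\<dots> \<le> S * \<epsilon>"
      proof (rule mult_right_mono)
        show "(\<Sum>c<s. \<bar>K $$ (i,c)\<bar>) \<le> S" unfolding S_def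
          by (rule member_le_sum[of i "{..<m}" "\<lambda>i. \<Sum>c<s. \<bar>K $$ (i,c)\<bar>"]) (use i in \<open>auto intro: sum_nonneg\<close>)
      qed (use \<epsilon> in simp)
      also have "\<dots> < e" using e S by (simp add: \<epsilon>_def field_simps)
      finally show ?thesis by (simp add: abs_minus_commute)
    qed
    then have "\<forall>i<m. \<bar>pi_perp s n (L *\<^sub>v r) $ i - y $ i\<bar> < e" using r perp by simp
    then show "\<exists>x\<in>(*\<^sub>v) L ` int_vecs s. \<forall>i<m. \<bar>pi_perp s n x $ i - y $ i\<bar> < e"
      using r by blast
  qed
  have C_int_vecs: "C *\<^sub>v r \<in> int_vecs s" if "r \<in> int_vecs s" for r
    using that C_int mult_mat_vec_carrier[OF C] by (auto simp: int_vecs_def scalar_prod_def intro!: Ints_sum Ints_mult)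
  have sub: "(\<lambda>v. A *\<^sub>v v) ` (pi_par n ` lattice_of L) \<subseteq> pi_par n ` lattice_of L"
  proof (unfold lattice, clarify)
    fix r assume r: "r \<in> int_vecs s"
    then have rc: "r \<in> carrier_vec s" by (rule int_carrier)
    have "A *\<^sub>v pi_par n (L *\<^sub>v r) = pi_par n (L *\<^sub>v (C *\<^sub>v r))"
      using rc AM assoc_mult_mat_vec[OF A M rc] assoc_mult_mat_vec[OF M C rc]
        mult_mat_vec_carrier[OF C rc] by (simp add: par)
    then show "A *\<^sub>v pi_par n (L *\<^sub>v r) \<in> pi_par n ` (*\<^sub>v) L ` int_vecs s"
      using C_int_vecs[OF r] by blast
  qed
  \<comment> \<open>Comparing right blocks in \<open>K * C = B * K\<close>, where that of
    \<open>K\<close> is the identity, leaves only this choice.\<close>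
  define B where "B = mat m m (\<lambda>(i,j). (K * C) $$ (i, n + j))"
  have B[simp]: "B \<in> carrier_mat m m" by (simp add: B_def)
  note [simp] = carrier_matD[OF B]
  have KC: "K * C = B * K"
  proof -
    \<comment> \<open>\<open>E\<close> has zero right part by the choice of \<open>B\<close>, and \<open>E J = 0\<close> with \<open>J\<close> invertible at the top
      kills the left part.\<close>
    define E where "E = K * C - B * K"
    have E[simp]: "E \<in> carrier_mat m s" by (simp add: E_def mult_carrier_mat[of _ m m] minus_carrier_mat)
    note [simp] = carrier_matD[OF E]
    have E2: "E $$ (i, n + j) = 0" if "i < m" "j < m" for i j
    proof -
      have "(B * K) $$ (i, n + j) = (\<Sum>c<m. B $$ (i,c) * K $$ (c, n + j))"
        using that by (simp add: scalar_prod_def s_eq atLeast0LessThan)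
      also have "\<dots> = (\<Sum>c<m. if c = j then B $$ (i,c) else 0)"
        by (rule sum.cong) (use that K1 in auto)
      finally show ?thesis using that by (simp add: E_def s_eq B_def)
    qed
    have EJ: "E * J = 0\<^sub>m m n"
    proof -
      have "E * J = K * C * J - B * K * J" unfolding E_def
        by (rule minus_mult_distrib_mat[of _ m s _ _ n]) (auto simp: mult_carrier_mat[of _ m m])
      also have "K * C * J = K * J * A"
        using assoc_mult_mat[OF K C J] assoc_mult_mat[OF K J A] CJ by simp
      also have "B * K * J = B * (K * J)" by (rule assoc_mult_mat[OF B K J])
      finally show ?thesis by (simp add: KJ)
    qed
    define E1 where "E1 = mat m n (($$) E)"
    have E1[simp]: "E1 \<in> carrier_mat m n" by (simp add: E1_def)
    have "E1 * J1 = 0\<^sub>m m n"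
    proof (rule eq_matI)
      fix i j assume "i < dim_row (0\<^sub>m m n :: real mat)" "j < dim_col (0\<^sub>m m n :: real mat)"
      then have ij: "i < m" "j < n" by auto
      have "(E1 * J1) $$ (i,j) = (\<Sum>c<n. E $$ (i,c) * J $$ (c,j))"
        using ij by (simp add: E1_def J1_def scalar_prod_def atLeast0LessThan)
      also have "\<dots> = (\<Sum>c<s. E $$ (i,c) * J $$ (c,j))"
      proof (rule sum.mono_neutral_left)
        show "\<forall>c\<in>{..<s} - {..<n}. E $$ (i,c) * J $$ (c,j) = 0"
        proof
          fix c assume "c \<in> {..<s} - {..<n}"
          then show "E $$ (i,c) * J $$ (c,j) = 0" using E2[OF ij(1), of "c - n"] by (auto simp: s_eq)
        qed
      qed (auto simp: s_eq)
      also have "\<dots> = (E * J) $$ (i,j)" using ij by (simp add: scalar_prod_def atLeast0LessThan)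
      finally show "(E1 * J1) $$ (i,j) = 0\<^sub>m m n $$ (i,j)" by (simp add: EJ)
    qed (auto simp: E1_def J1_def)
    then have "E1 * J1 * X = 0\<^sub>m m n" using left_mult_zero_mat[OF X] by simp
    then have "E1 = 0\<^sub>m m n"
      using assoc_mult_mat[OF E1 _ X, of J1] JX right_mult_one_mat[OF E1] by simp
    then have E_1: "E $$ (i,j) = 0" if "i < m" "j < n" for i j
      using that by (metis E1_def index_mat(1) index_zero_mat(1) case_prod_conv)
    show ?thesis
    proof (rule eq_matI)
      fix i j assume "i < dim_row (B * K)" "j < dim_col (B * K)"
      then have ij: "i < m" "j < s" by auto
      have "E $$ (i,j) = 0" using E_1[OF ij(1), of j] E2[OF ij(1), of "j - n"] ij
        by (cases "j < n") (auto simp: s_eq)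
      then show "(K * C) $$ (i,j) = (B * K) $$ (i,j)" using ij by (simp add: E_def)
    qed auto
  qed
  have block: "four_block_mat A (0\<^sub>m n m) (0\<^sub>m m n) B * L = L * C"
  proof (rule eq_matI)
    let ?F = "four_block_mat A (0\<^sub>m n m) (0\<^sub>m m n) B"
    fix i j assume "i < dim_row (L * C)" "j < dim_col (L * C)"
    then have ij: "i < s" "j < s" by auto
    have "(?F * L) $$ (i,j) = (\<Sum>c\<in>{..<n} \<union> {n..<s}. ?F $$ (i,c) * L $$ (c,j))"
      using ij by (simp add: scalar_prod_def s_eq atLeast0LessThan ivl_disj_un)
    also have "\<dots> = (\<Sum>c<n. ?F $$ (i,c) * L $$ (c,j)) + (\<Sum>c\<in>{n..<s}. ?F $$ (i,c) * L $$ (c,j))"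
      by (rule sum.union_disjoint) auto
    also have "(\<Sum>c\<in>{n..<s}. ?F $$ (i,c) * L $$ (c,j)) = (\<Sum>c<m. ?F $$ (i,n+c) * L $$ (n+c,j))"
      by (rule sum.reindex_bij_witness[of _ "\<lambda>c. n + c" "\<lambda>c. c - n"]) (auto simp: s_eq)
    also have "(\<Sum>c<n. ?F $$ (i,c) * L $$ (c,j)) = (if i < n then (A * M) $$ (i,j) else 0)"
      using ij by (auto simp: L_def s_eq scalar_prod_def atLeast0LessThan intro!: sum.cong)
    also have "(\<Sum>c<m. ?F $$ (i,n+c) * L $$ (n+c,j)) = (if i < n then 0 else (B * K) $$ (i - n,j))"
      using ij by (auto simp: L_def s_eq scalar_prod_def atLeast0LessThan intro!: sum.cong)
    finally show "(?F * L) $$ (i,j) = (L * C) $$ (i,j)"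
      using LR[OF C ij] by (simp add: AM KC)
  qed (auto simp: s_eq)
  have "generic_cps s n L"
    using nondeg aper irred n detL by (simp add: generic_cps_def cut_and_project_def)
  moreover have "self_similarity s n L A" unfolding self_similarity_def m_def[symmetric]
    using sub block B C C_int A by blast
  ultimately show ?thesis by blast
qed

section \<open>Generic choice of the parameters\<close>

lemma sum_block:
  fixes f :: "nat \<Rightarrow> 'a :: comm_monoid_add"
  shows "(\<Sum>c<d * N. f c) = (\<Sum>k<d. \<Sum>j<N. f (k * N + j))"
proof (induction d)
  case (Suc d)
  have "(\<Sum>c<Suc d * N. f c) = (\<Sum>c\<in>{..<d * N} \<union> {d * N..<d * N + N}. f c)"
    by (rule sum.cong) auto
  also have "\<dots> = (\<Sum>c<d * N. f c) + (\<Sum>c=d * N..<d * N + N. f c)"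
    by (rule sum.union_disjoint) auto
  also have "(\<Sum>c=d * N..<d * N + N. f c) = (\<Sum>j<N. f (d * N + j))"
    by (rule sum.reindex_bij_witness[of _ "\<lambda>j. d * N + j" "\<lambda>c. c - d * N"]) auto
  finally show ?case using Suc by simp
qed simp

text \<open>The last property is what makes \<open>W\<close> below generic enough: its last row is forced by \<open>\<tau> W = 0\<close>,
  which turns a condition on \<open>W\<close> with coefficients \<open>R j\<close> into one on the square top part of \<open>W\<close>
  with coefficients \<open>R m - \<tau> m R n\<close>.\<close>
lemma generic_orthogonal_form:
  fixes Z :: "'i :: countable \<Rightarrow> nat \<Rightarrow> real" and P R :: "'i \<Rightarrow> nat \<Rightarrow> nat \<Rightarrow> nat \<Rightarrow> real"
  assumes "1 \<le> n"
  obtains \<tau> :: "nat \<Rightarrow> real" where "\<tau> n = 1"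
    and "\<And>i k. k \<le> n \<Longrightarrow> Z i k \<noteq> 0 \<Longrightarrow> (\<Sum>j\<le>n. Z i j * \<tau> j) \<noteq> 0"
    and "\<And>i a l k. k \<le> n \<Longrightarrow> P i k a l \<noteq> 0 \<Longrightarrow> (\<Sum>j\<le>n. P i j a l * \<tau> j) \<noteq> 0"
    and "\<And>i l a k. k \<le> n \<Longrightarrow> R i k l a \<noteq> 0 \<Longrightarrow> \<exists>m<n. R i m l a - \<tau> m * R i n l a \<noteq> 0"
proof -
  \<comment> \<open>A sum type merges the three families for a single generic choice. With
    \<open>v n = 1\<close>, the last kind of form evaluates to
    \<open>R i 0 l a - v 0 * R i n l a\<close>.\<close>
  define f where "f s j = (case s of Inl i \<Rightarrow> Z i j | Inr (Inl (i, a, l)) \<Rightarrow> P i j a l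
    | Inr (Inr (i, l, a)) \<Rightarrow> if j = 0 then - R i n l a else if j = n then R i 0 l a else 0)"
    for s :: "'i + ('i \<times> nat \<times> nat) + ('i \<times> nat \<times> nat)" and j
  obtain v where v: "v n = 1" "\<And>s k. k < Suc n \<Longrightarrow> f s k \<noteq> 0 \<Longrightarrow> (\<Sum>j<Suc n. f s j * v j) \<noteq> 0"
    using nonvanishing_of_countable_forms[of n "Suc n" f] by blast
  show ?thesis
  proof (rule that[of v])
    show "v n = 1" by (rule v)
    show "(\<Sum>j\<le>n. Z i j * v j) \<noteq> 0" if "k \<le> n" "Z i k \<noteq> 0" for i k
      using v(2)[of k "Inl i"] that by (simp add: f_def lessThan_Suc_atMost)
    show "(\<Sum>j\<le>n. P i j a l * v j) \<noteq> 0" if "k \<le> n" "P i k a l \<noteq> 0" for i a l k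
      using v(2)[of k "Inr (Inl (i, a, l))"] that by (simp add: f_def lessThan_Suc_atMost)
    show "\<exists>m<n. R i m l a - v m * R i n l a \<noteq> 0" if k: "k \<le> n" "R i k l a \<noteq> 0" for i l a k
    \<comment> \<open>If this entry is zero, \<open>k\<close> itself works and lies below
      \<open>n\<close>; otherwise index 0 works by the third kind of form.\<close>
    proof (cases "R i n l a = 0")
      case True
      then show ?thesis using k by (intro exI[of _ k]) (auto simp: le_less)
    next
      case False
      let ?s = "Inr (Inr (i, l, a))"
      have "(\<Sum>j<Suc n. f ?s j * v j) = (\<Sum>j\<in>{0, n}. f ?s j * v j)"
        by (rule sum.mono_neutral_right) (auto simp: f_def)
      also have "\<dots> = R i 0 l a - v 0 * R i n l a"
        using \<open>1 \<le> n\<close> v(1) by (simp add: f_def)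
      finally show ?thesis using v(2)[of 0 ?s] False \<open>1 \<le> n\<close>
        by (intro exI[of _ 0]) (auto simp: f_def)
    qed
  qed
qed

text \<open>A generic \<open>E\<close> need not be known to be invertible, but \<open>E - c\<close> is for all but finitely many \<open>c\<close>.\<close>
lemma generic_invertible_matrix:
  fixes T :: "'i :: countable \<Rightarrow> nat \<Rightarrow> nat \<Rightarrow> real"
  assumes "1 \<le> n"
  obtains X :: "real mat" where "X \<in> carrier_mat n n" "det X \<noteq> 0"
    and "\<And>i m l. m < n \<Longrightarrow> l < n \<Longrightarrow> T i m l \<noteq> 0 \<Longrightarrow> (\<Sum>m<n. \<Sum>l<n. T i m l * X $$ (m,l)) \<noteq> 0"
proof -
  have nn: "0 < n * n" using assms by simp
  obtain v :: "nat \<Rightarrow> real" where "v 0 = 1" and v: "\<And>i k. k < n * n \<Longrightarrow> T i (k div n) (k mod n) \<noteq> 0 \<Longrightarrow>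
      (\<Sum>j<n * n. T i (j div n) (j mod n) * v j) \<noteq> 0"
    by (rule nonvanishing_of_countable_forms[where f = "\<lambda>i k. T i (k div n) (k mod n)", OF nn], rule that)
  define E where "E = mat n n (\<lambda>(m,l). v (m * n + l))"
  have E: "E \<in> carrier_mat n n" by (simp add: E_def)
  have TE: "(\<Sum>m<n. \<Sum>l<n. T i m l * E $$ (m,l)) \<noteq> 0" if "m < n" "l < n" "T i m l \<noteq> 0" for i m l
  proof -
    have "m * n + l < n * n" using that mult_le_mono1[of "Suc m" n n] by simp
    then have "(\<Sum>j<n * n. T i (j div n) (j mod n) * v j) \<noteq> 0"
      using v[of "m * n + l" i] that by simp
    then show ?thesis by (simp add: sum_block E_def)
  qed
  \<comment> \<open>The value of form \<open>i\<close> at \<open>E - c\<close>, as a polynomial in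
    \<open>c\<close>. Its constant term is the value at \<open>E\<close>, nonzero whenever
    \<open>T i\<close> has a nonzero entry.\<close>
  define p where "p i = [:\<Sum>m<n. \<Sum>l<n. T i m l * E $$ (m,l), - (\<Sum>m<n. T i m m):]" for i
  obtain c where c: "\<And>q. q \<in> insert (char_poly E) (p ` UNIV - {0}) \<Longrightarrow> poly q c \<noteq> 0"
  proof (rule nonroot_of_countable_polys)
    show "countable (insert (char_poly E) (p ` UNIV - {0}))" by auto
    show "0 \<notin> insert (char_poly E) (p ` UNIV - {0})"
      using degree_monic_char_poly[OF E] by auto
  qed blast
  \<comment> \<open>This is \<open>E - c\<close>, invertible since \<open>c\<close> is no root of
    \<open>char_poly E\<close>.\<close>
  define X where "X = char_matrix E c"
  have X: "X \<in> carrier_mat n n" using E by (simp add: X_def)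
  moreover have "det X \<noteq> 0"
    using c[of "char_poly E"] eigenvalue_det[OF E] eigenvalue_root_char_poly[OF E] by (simp add: X_def)
  moreover have "(\<Sum>m<n. \<Sum>l<n. T i m l * X $$ (m,l)) \<noteq> 0" if "m < n" "l < n" "T i m l \<noteq> 0" for i m l
  proof -
    have "(\<Sum>m<n. \<Sum>l<n. T i m l * X $$ (m,l)) = (\<Sum>m<n. \<Sum>l<n. T i m l * E $$ (m,l) - (if l = m then c * T i m m else 0))"
      using E by (intro sum.cong) (auto simp: X_def char_matrix_def algebra_simps)
    also have "\<dots> = poly (p i) c"
      by (simp add: p_def sum_subtractf sum_distrib_left)
    finally show ?thesis using c[of "p i"] TE[OF that] by (auto simp: p_def)
  qed
  ultimately show ?thesis using that by blast
qed

text \<open>The choices are made in the order \<open>\<tau>\<close>, top part \<open>X\<close> of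
  \<open>W\<close>, \<open>x\<close>, \<open>U\<close>. As \<open>\<tau> W = 0\<close>, adding
  \<open>z l * \<tau> j\<close> to a left inverse of \<open>W\<close> keeps it a left inverse, and
  \<open>z\<close> supplies the freedom for the condition on \<open>U\<close>. The families
  \<open>Z\<close>, \<open>P\<close>, \<open>R\<close> will test integer vectors against the image
  of \<open>J\<close>, the kernel of \<open>M\<close> and the direction \<open>J x\<close>.\<close>

lemma generic_parameters:
  fixes Z :: "'i :: countable \<Rightarrow> nat \<Rightarrow> real" and P R :: "'i \<Rightarrow> nat \<Rightarrow> nat \<Rightarrow> nat \<Rightarrow> real"
  assumes "1 \<le> n"
  obtains \<tau> x :: "nat \<Rightarrow> real" and U W :: "real mat"
  where "U \<in> carrier_mat n (Suc n)" "W \<in> carrier_mat (Suc n) n" "U * W = 1\<^sub>m n"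
    and "det (mat n n (($$) W)) \<noteq> 0"
    and "\<And>l. l < n \<Longrightarrow> (\<Sum>j\<le>n. \<tau> j * W $$ (j,l)) = 0"
    and "\<And>i k. k \<le> n \<Longrightarrow> Z i k \<noteq> 0 \<Longrightarrow> (\<Sum>j\<le>n. Z i j * \<tau> j) \<noteq> 0"
    and "\<And>i k a l. k \<le> n \<Longrightarrow> l < n \<Longrightarrow> P i k a l \<noteq> 0 \<Longrightarrow> (\<Sum>j\<le>n. \<Sum>l<n. P i j a l * U $$ (l,j)) \<noteq> 0"
    and "\<And>i k a l. k \<le> n \<Longrightarrow> l < n \<Longrightarrow> a < n \<Longrightarrow> R i k l a \<noteq> 0 \<Longrightarrow>
      (\<Sum>a<n. (\<Sum>j\<le>n. \<Sum>l<n. W $$ (j,l) * R i j l a) * x a) \<noteq> 0"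
proof -
  obtain \<tau> :: "nat \<Rightarrow> real" where \<tau>n: "\<tau> n = 1"
    and \<tau>Z: "\<And>i k. k \<le> n \<Longrightarrow> Z i k \<noteq> 0 \<Longrightarrow> (\<Sum>j\<le>n. Z i j * \<tau> j) \<noteq> 0"
    and \<tau>P: "\<And>i a l k. k \<le> n \<Longrightarrow> P i k a l \<noteq> 0 \<Longrightarrow> (\<Sum>j\<le>n. P i j a l * \<tau> j) \<noteq> 0"
    and \<tau>R: "\<And>i l a k. k \<le> n \<Longrightarrow> R i k l a \<noteq> 0 \<Longrightarrow> \<exists>m<n. R i m l a - \<tau> m * R i n l a \<noteq> 0"
    using generic_orthogonal_form[OF assms, of Z P R] by blast
  \<comment> \<open>Coefficients on \<open>X\<close> after the last row of \<open>W\<close> is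
    eliminated through \<open>\<tau> W = 0\<close>.\<close>
  define T where "T = (\<lambda>(i,a) m l. R i m l a - \<tau> m * R i n l a)"
  obtain X where X: "X \<in> carrier_mat n n" "det X \<noteq> 0"
    and XT: "\<And>i m l. m < n \<Longrightarrow> l < n \<Longrightarrow> T i m l \<noteq> 0 \<Longrightarrow> (\<Sum>m<n. \<Sum>l<n. T i m l * X $$ (m,l)) \<noteq> 0"
    using generic_invertible_matrix[OF assms, of T] by blast
  obtain Y where Y: "Y \<in> carrier_mat n n" "Y * X = 1\<^sub>m n"
    using det_nonzero_inverse[OF X] by metis
  note [simp] = carrier_matD[OF X(1)] carrier_matD[OF Y(1)]
  define W where "W = mat (Suc n) n (\<lambda>(j,l). if j < n then X $$ (j,l) else - (\<Sum>m<n. \<tau> m * X $$ (m,l)))"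
  have W: "W \<in> carrier_mat (Suc n) n" by (simp add: W_def)
  have \<tau>W: "(\<Sum>j\<le>n. \<tau> j * W $$ (j,l)) = 0" if "l < n" for l
  proof -
    have "(\<Sum>j\<le>n. \<tau> j * W $$ (j,l)) = (\<Sum>j<n. \<tau> j * W $$ (j,l)) + W $$ (n,l)"
      by (simp add: \<tau>n flip: lessThan_Suc_atMost)
    also have "\<dots> = 0" using that by (simp add: W_def)
    finally show ?thesis .
  qed
  have WR: "(\<Sum>j\<le>n. \<Sum>l<n. W $$ (j,l) * R i j l a) = (\<Sum>m<n. \<Sum>l<n. T (i,a) m l * X $$ (m,l))" for i a
  proof -
    have "(\<Sum>j\<le>n. \<Sum>l<n. W $$ (j,l) * R i j l a)
        = (\<Sum>j<n. \<Sum>l<n. W $$ (j,l) * R i j l a) + (\<Sum>l<n. W $$ (n,l) * R i n l a)"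
      by (simp flip: lessThan_Suc_atMost)
    also have "(\<Sum>l<n. W $$ (n,l) * R i n l a) = - (\<Sum>l<n. \<Sum>m<n. \<tau> m * X $$ (m,l) * R i n l a)"
      by (simp add: W_def sum_distrib_right sum_negf)
    also have "(\<Sum>l<n. \<Sum>m<n. \<tau> m * X $$ (m,l) * R i n l a) = (\<Sum>m<n. \<Sum>l<n. \<tau> m * X $$ (m,l) * R i n l a)"
      by (rule sum.swap)
    also have "(\<Sum>j<n. \<Sum>l<n. W $$ (j,l) * R i j l a) = (\<Sum>m<n. \<Sum>l<n. X $$ (m,l) * R i m l a)"
      by (simp add: W_def)
    finally show ?thesis by (simp add: T_def algebra_simps sum_subtractf)
  qed
  have n0: "0 < n" using assms by simp
  obtain x :: "nat \<Rightarrow> real" where "x 0 = 1" and x: "\<And>i a. a < n \<Longrightarrow> (\<Sum>j\<le>n. \<Sum>l<n. W $$ (j,l) * R i j l a) \<noteq> 0 \<Longrightarrow>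
      (\<Sum>a<n. (\<Sum>j\<le>n. \<Sum>l<n. W $$ (j,l) * R i j l a) * x a) \<noteq> 0"
    by (rule nonvanishing_of_countable_forms[where f = "\<lambda>i a. \<Sum>j\<le>n. \<Sum>l<n. W $$ (j,l) * R i j l a", OF n0], rule that)
  \<comment> \<open>The condition on \<open>U\<close> as a form in \<open>z\<close>: slot
    \<open>n\<close> holds the constant contribution of \<open>Y\<close>, which is why
    \<open>z n = 1\<close> is arranged.\<close>
  define f where "f = (\<lambda>(i,a) l. if l < n then \<Sum>j\<le>n. P i j a l * \<tau> j else \<Sum>j<n. \<Sum>l<n. P i j a l * Y $$ (l,j))"
  obtain z :: "nat \<Rightarrow> real" where zn: "z n = 1"
    and z: "\<And>i k. k < Suc n \<Longrightarrow> f i k \<noteq> 0 \<Longrightarrow> (\<Sum>l<Suc n. f i l * z l) \<noteq> 0"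
    using nonvanishing_of_countable_forms[of n "Suc n" f] by blast
  \<comment> \<open>The inverse \<open>Y\<close> of \<open>X\<close> with a zero column appended,
    plus the product of \<open>z\<close> and \<open>\<tau>\<close>, which multiplication by
    \<open>W\<close> annihilates.\<close>
  define U where "U = mat n (Suc n) (\<lambda>(l,j). (if j < n then Y $$ (l,j) else 0) + z l * \<tau> j)"
  have U: "U \<in> carrier_mat n (Suc n)" by (simp add: U_def)
  have "U * W = 1\<^sub>m n"
  proof (rule eq_matI)
    fix i l assume "i < dim_row (1\<^sub>m n :: real mat)" "l < dim_col (1\<^sub>m n :: real mat)"
    then have il: "i < n" "l < n" by auto
    have "(U * W) $$ (i,l) = (\<Sum>j<Suc n. U $$ (i,j) * W $$ (j,l))"
      using il U W by (simp add: scalar_prod_def atLeast0LessThan)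
    also have "\<dots> = (\<Sum>j<Suc n. (if j < n then Y $$ (i,j) * X $$ (j,l) else 0) + z i * (\<tau> j * W $$ (j,l)))"
      using il by (intro sum.cong) (auto simp: U_def W_def algebra_simps)
    also have "\<dots> = (\<Sum>j<n. Y $$ (i,j) * X $$ (j,l)) + z i * (\<Sum>j\<le>n. \<tau> j * W $$ (j,l))"
      unfolding sum.distrib by (simp add: sum_distrib_left distrib_left flip: lessThan_Suc_atMost)
    also have "\<dots> = (Y * X) $$ (i,l)"
      using il by (simp add: \<tau>W scalar_prod_def atLeast0LessThan)
    finally show "(U * W) $$ (i,l) = 1\<^sub>m n $$ (i,l)" by (simp add: Y)
  qed (auto simp: U_def W_def)
  moreover have "mat n n (($$) W) = X" by (rule eq_matI) (auto simp: W_def)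
  moreover have "(\<Sum>j\<le>n. \<Sum>l<n. P i j a l * U $$ (l,j)) \<noteq> 0" if "k \<le> n" "l < n" "P i k a l \<noteq> 0" for i k a l
  proof -
    have "(\<Sum>j\<le>n. \<Sum>l<n. P i j a l * U $$ (l,j))
        = (\<Sum>j<Suc n. \<Sum>l<n. (if j < n then P i j a l * Y $$ (l,j) else 0) + P i j a l * \<tau> j * z l)"
      unfolding lessThan_Suc_atMost[symmetric] by (intro sum.cong) (auto simp: U_def algebra_simps)
    also have "\<dots> = (\<Sum>j<n. \<Sum>l<n. P i j a l * Y $$ (l,j)) + (\<Sum>j<Suc n. \<Sum>l<n. P i j a l * \<tau> j * z l)"
      unfolding sum.distrib by simp
    also have "(\<Sum>j<Suc n. \<Sum>l<n. P i j a l * \<tau> j * z l) = (\<Sum>l<n. (\<Sum>j\<le>n. P i j a l * \<tau> j) * z l)"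
      unfolding sum_distrib_right lessThan_Suc_atMost by (rule sum.swap)
    also have "(\<Sum>j<n. \<Sum>l<n. P i j a l * Y $$ (l,j)) + (\<Sum>l<n. (\<Sum>j\<le>n. P i j a l * \<tau> j) * z l)
        = (\<Sum>l<Suc n. f (i,a) l * z l)"
      by (simp add: f_def zn)
    finally show ?thesis using z[of l "(i,a)"] \<tau>P[OF that(1,3)] that(2) by (simp add: f_def)
  qed
  moreover have "(\<Sum>a<n. (\<Sum>j\<le>n. \<Sum>l<n. W $$ (j,l) * R i j l a) * x a) \<noteq> 0"
    if k: "k \<le> n" and l: "l < n" and a: "a < n" and nz: "R i k l a \<noteq> 0" for i k a l
  proof -
    obtain m where "m < n" "T (i,a) m l \<noteq> 0" using \<tau>R[OF k nz] by (auto simp: T_def)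
    then show ?thesis using x[OF a] XT[OF _ l] unfolding WR by blast
  qed
  ultimately show ?thesis using that[of U W \<tau> x] U W \<tau>W \<tau>Z X by simp
qed

section \<open>Block matrices and the companion matrix\<close>

text \<open>Coordinate \<open>k * N + j\<close> is position \<open>j\<close> of block \<open>k\<close>.\<close>

definition block_row :: "nat \<Rightarrow> nat \<Rightarrow> nat \<Rightarrow> (nat \<Rightarrow> real mat) \<Rightarrow> real mat" where
  "block_row d N n F = mat n (d * N) (\<lambda>(i,c). F (c div N) $$ (i, c mod N))"

definition block_col :: "nat \<Rightarrow> nat \<Rightarrow> nat \<Rightarrow> (nat \<Rightarrow> real mat) \<Rightarrow> real mat" where
  "block_col d N n G = mat (d * N) n (\<lambda>(c,i). G (c div N) $$ (c mod N, i))"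

text \<open>The Kronecker product of the matrix \<open>\<gamma>\<close> with the identity of size
  \<open>N\<close>, that is, \<open>N\<close> copies of \<open>\<gamma>\<close> up to reordering
  coordinates.\<close>

definition block_scalar :: "nat \<Rightarrow> nat \<Rightarrow> (nat \<Rightarrow> nat \<Rightarrow> int) \<Rightarrow> real mat" where
  "block_scalar d N \<gamma> = mat (d * N) (d * N)
     (\<lambda>(c,c'). if c mod N = c' mod N then of_int (\<gamma> (c div N) (c' div N)) else 0)"

lemma block_carrier [simp]:
  "block_row d N n F \<in> carrier_mat n (d * N)"
  "block_col d N n G \<in> carrier_mat (d * N) n"
  "block_scalar d N \<gamma> \<in> carrier_mat (d * N) (d * N)"
  by (auto simp: block_row_def block_col_def block_scalar_def)

lemma block_dim [simp]:
  "dim_row (block_row d N n F) = n" "dim_col (block_row d N n F) = d * N"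
  "dim_row (block_col d N n G) = d * N" "dim_col (block_col d N n G) = n"
  "dim_row (block_scalar d N \<gamma>) = d * N" "dim_col (block_scalar d N \<gamma>) = d * N"
  by (auto simp: block_row_def block_col_def block_scalar_def)

lemma block_index_less:
  fixes k j d N :: nat
  assumes "k < d" "j < N"
  shows "k * N + j < d * N"
proof -
  have "k * N + j < Suc k * N" using assms by simp
  also have "\<dots> \<le> d * N" using assms by (intro mult_le_mono1) simp
  finally show ?thesis .
qed

lemma block_index [simp]:
  assumes "k < d" "j < N"
  shows "i < n \<Longrightarrow> block_row d N n F $$ (i, k * N + j) = F k $$ (i,j)"
    and "i < n \<Longrightarrow> block_col d N n G $$ (k * N + j, i) = G k $$ (j,i)"
    and "k' < d \<Longrightarrow> j' < N \<Longrightarrow> block_scalar d N \<gamma> $$ (k * N + j, k' * N + j') = (if j = j' then of_int (\<gamma> k k') else 0)"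
  using assms by (auto simp: block_row_def block_col_def block_scalar_def block_index_less)

lemma block_index_cases:
  fixes c d N :: nat
  assumes "c < d * N"
  obtains k j where "k < d" "j < N" "c = k * N + j"
proof
  have "0 < N" using assms by (cases N) auto
  then show "c div N < d" "c mod N < N" "c = c div N * N + c mod N"
    using assms by (auto simp: less_mult_imp_div_less)
qed

lemma mult_block_row_col:
  assumes "\<And>k. k < d \<Longrightarrow> F k \<in> carrier_mat n N" "\<And>k. k < d \<Longrightarrow> G k \<in> carrier_mat N n" "i < n" "i' < n"
  shows "(block_row d N n F * block_col d N n G) $$ (i,i') = (\<Sum>k<d. (F k * G k) $$ (i,i'))"
proof -
  have "(block_row d N n F * block_col d N n G) $$ (i,i')
      = (\<Sum>k<d. \<Sum>j<N. F k $$ (i,j) * G k $$ (j,i'))"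
    using assms(3,4) by (simp add: scalar_prod_def atLeast0LessThan sum_block)
  also have "\<dots> = (\<Sum>k<d. (F k * G k) $$ (i,i'))"
    using assms(3,4) carrier_matD[OF assms(1)] carrier_matD[OF assms(2)]
    by (intro sum.cong) (auto simp: scalar_prod_def atLeast0LessThan)
  finally show ?thesis .
qed

lemma mult_block_row_scalar:
  assumes "i < n" "k' < d" "j < N"
  shows "(block_row d N n F * block_scalar d N \<gamma>) $$ (i, k' * N + j) = (\<Sum>k<d. of_int (\<gamma> k k') * F k $$ (i,j))"
proof -
  have "(block_row d N n F * block_scalar d N \<gamma>) $$ (i, k' * N + j)
      = (\<Sum>k<d. \<Sum>j'<N. F k $$ (i,j') * (if j' = j then of_int (\<gamma> k k') else 0))"
    using assms by (simp add: scalar_prod_def atLeast0LessThan sum_block block_index_less)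
  also have "\<dots> = (\<Sum>k<d. of_int (\<gamma> k k') * F k $$ (i,j))"
    using assms by (intro sum.cong) (auto simp: if_distrib[of "\<lambda>x. _ * x"] mult.commute cong: if_cong)
  finally show ?thesis .
qed

lemma mult_block_scalar_col:
  assumes "i < n" "k < d" "j < N"
  shows "(block_scalar d N \<gamma> * block_col d N n G) $$ (k * N + j, i) = (\<Sum>k'<d. of_int (\<gamma> k k') * G k' $$ (j,i))"
proof -
  have "(block_scalar d N \<gamma> * block_col d N n G) $$ (k * N + j, i)
      = (\<Sum>k'<d. \<Sum>j'<N. (if j = j' then of_int (\<gamma> k k') else 0) * G k' $$ (j',i))"
    using assms by (simp add: scalar_prod_def atLeast0LessThan sum_block block_index_less)
  also have "\<dots> = (\<Sum>k'<d. of_int (\<gamma> k k') * G k' $$ (j,i))"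
    using assms by (intro sum.cong) (auto simp: if_distrib[of "\<lambda>x. x * _"] cong: if_cong)
  finally show ?thesis .
qed

lemma mult_mat_block_row:
  assumes "A \<in> carrier_mat n n" "F k \<in> carrier_mat n N" "i < n" "k < d" "j < N"
  shows "(A * block_row d N n F) $$ (i, k * N + j) = (A * F k) $$ (i,j)"
  using assms by (simp add: scalar_prod_def block_index_less)

lemma mult_block_col_mat:
  assumes "A \<in> carrier_mat n n" "G k \<in> carrier_mat N n" "i < n" "k < d" "j < N"
  shows "(block_col d N n G * A) $$ (k * N + j, i) = (G k * A) $$ (j,i)"
  using assms by (simp add: scalar_prod_def block_index_less)

section \<open>Horner polynomials and the companion matrix in the reversed power basis\<close>

text \<open>This is \<open>(p(x) - p(y)) / (x - y) = \<Sum> x^(d-1-k) g_k(y)\<close> at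
  \<open>y = x\<close>, with Horner polynomials \<open>g_k = poly_shift (d - k) p\<close>.
  Coefficientwise, \<open>coeff p (Suc i)\<close> is collected once for each power of
  \<open>x\<close> up to \<open>i\<close>.\<close>

lemma pderiv_eq_sum_poly_shift:
  fixes p :: "'a :: {comm_semiring_1, semiring_no_zero_divisors} poly"
  shows "(\<Sum>k<degree p. monom 1 (degree p - 1 - k) * poly_shift (degree p - k) p) = pderiv p"
proof (rule poly_eqI)
  fix i
  let ?d = "degree p"
  have "coeff (\<Sum>k<?d. monom 1 (?d - 1 - k) * poly_shift (?d - k) p) i
      = (\<Sum>k<?d. if ?d - 1 - k \<le> i then coeff p (Suc i) else 0)"
    unfolding coeff_sum
  proof (rule sum.cong)
    fix k assume "k \<in> {..<?d}"
    then have "?d - 1 - k \<le> i \<Longrightarrow> i - (?d - 1 - k) + (?d - k) = Suc i" by auto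
    then show "coeff (monom 1 (?d - 1 - k) * poly_shift (?d - k) p) i = (if ?d - 1 - k \<le> i then coeff p (Suc i) else 0)"
      by (auto simp: coeff_monom_mult coeff_poly_shift)
  qed simp
  also have "\<dots> = (\<Sum>m<?d. if m \<le> i then coeff p (Suc i) else 0)"
    using sum.nat_diff_reindex[of "\<lambda>m. if m \<le> i then coeff p (Suc i) else 0" ?d] by simp
  also have "\<dots> = of_nat (Suc i) * coeff p (Suc i)"
  proof (cases "Suc i \<le> ?d")
    case True
    have "(\<Sum>m<?d. if m \<le> i then coeff p (Suc i) else 0) = (\<Sum>m<Suc i. coeff p (Suc i))"
      by (rule sum.mono_neutral_cong_right) (use True in auto)
    then show ?thesis by simp
  qed (simp add: coeff_eq_0)
  finally show "coeff (\<Sum>k<?d. monom 1 (?d - 1 - k) * poly_shift (?d - k) p) i = coeff (pderiv p) i"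
    by (simp add: coeff_pderiv)
qed

text \<open>Index \<open>k\<close> stands for the power \<open>x^(d-1-k)\<close>. The reversal puts the block \<open>W g_0(A) = W\<close>
  at the top of \<open>J\<close>, where an invertible square part is needed.\<close>
definition rev_companion :: "int poly \<Rightarrow> nat \<Rightarrow> nat \<Rightarrow> int" where
  "rev_companion p k k' = (if k' = 0 then - coeff p (degree p - 1 - k) else if k' = Suc k then 1 else 0)"

text \<open>Multiplication by \<open>x\<close> lowers the index by one; at index 0 the power
  \<open>x^d\<close> overflows and is reduced by the monic \<open>p\<close>, whose contribution
  stays explicit. Once \<open>\<Phi> p\<close> is zero, this becomes
  \<open>A M = M C\<close>.\<close>

lemma rev_companion_monom:
  assumes "lead_coeff p = 1" "k' < degree p"
  shows "pCons 0 (monom 1 (degree p - 1 - k'))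
    = (if k' = 0 then p else 0) + (\<Sum>k<degree p. smult (rev_companion p k k') (monom 1 (degree p - 1 - k)))"
proof (cases "k' = 0")
  case True
  let ?d = "degree p"
  have "(\<Sum>k<?d. smult (rev_companion p k k') (monom 1 (?d - 1 - k)))
      = (\<Sum>k<?d. - monom (coeff p (?d - 1 - k)) (?d - 1 - k))"
    by (intro sum.cong) (auto simp: rev_companion_def True smult_monom simp flip: minus_monom)
  also have "\<dots> = - (\<Sum>m<?d. monom (coeff p m) m)"
    using sum.nat_diff_reindex[of "\<lambda>m. - monom (coeff p m) m" ?d] by (simp add: sum_negf)
  also have "(\<Sum>m<?d. monom (coeff p m) m) = p - monom 1 ?d"
    using poly_as_sum_of_monoms[of p] assms(1) by (simp add: algebra_simps flip: lessThan_Suc_atMost)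
  finally show ?thesis using True assms(2) by (simp flip: monom_Suc)
next
  case False
  then obtain k0 where k0: "k' = Suc k0" by (cases k') auto
  have "(\<Sum>k<degree p. smult (rev_companion p k k') (monom 1 (degree p - 1 - k)))
      = (\<Sum>k<degree p. if k = k0 then monom 1 (degree p - 1 - k) else 0)"
    by (intro sum.cong) (auto simp: rev_companion_def k0)
  also have "\<dots> = monom 1 (degree p - 1 - k0)" using assms(2) k0 by simp
  also have "degree p - 1 - k0 = Suc (degree p - 1 - k')" using assms(2) k0 by simp
  finally show ?thesis using False by (simp add: monom_Suc)
qed

text \<open>Horner's recursion \<open>g_(k+1) = x g_k + a_(d-1-k)\<close>, ending with
  \<open>g_d = p\<close>, which is the term subtracted in the last row. Once \<open>\<Phi> p\<close>
  is zero, this becomes \<open>C J = J A\<close>.\<close>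

lemma rev_companion_poly_shift:
  assumes "lead_coeff p = 1" "k < degree p"
  shows "(\<Sum>k'<degree p. smult (rev_companion p k k') (poly_shift (degree p - k') p))
    = pCons 0 (poly_shift (degree p - k) p) - (if Suc k = degree p then p else 0)"
proof -
  let ?d = "degree p" and ?g = "\<lambda>k. poly_shift (degree p - k) p"
  have g0: "poly_shift ?d p = 1"
    using assms(1) by (intro poly_eqI) (auto simp: coeff_poly_shift coeff_eq_0)
  have gS: "?g (Suc k) = pCons 0 (?g k) + [:coeff p (?d - 1 - k):]"
    using assms(2) by (intro poly_eqI) (auto simp: coeff_poly_shift coeff_pCons Suc_diff_Suc split: nat.split)
  have "(\<Sum>k'<?d. smult (rev_companion p k k') (?g k'))
      = (\<Sum>k'<?d. (if k' = 0 then [:- coeff p (?d - 1 - k):] else 0) + (if k' = Suc k then ?g k' else 0))"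
    by (intro sum.cong) (auto simp: rev_companion_def g0)
  also have "\<dots> = [:- coeff p (?d - 1 - k):] + (if Suc k < ?d then ?g (Suc k) else 0)"
    using assms(2) by (auto simp: sum.distrib sum.delta')
  also have "\<dots> = pCons 0 (?g k) - (if Suc k = ?d then p else 0)"
  proof (cases "Suc k < ?d")
    case True
    then show ?thesis by (simp add: gS)
  next
    case False
    then have k: "Suc k = ?d" using assms(2) by simp
    have "[:- coeff p (?d - 1 - k):] = pCons 0 (?g k) - ?g (Suc k)" unfolding gS by simp
    then show ?thesis using k by (simp add: poly_shift_0)
  qed
  finally show ?thesis .
qed


section \<open>Assembly of the scheme from the minimal polynomial\<close>

lemma sum_swap_outer:
  "(\<Sum>k\<in>A. \<Sum>j\<in>B. \<Sum>a\<in>C. f k j a) = (\<Sum>a\<in>C. \<Sum>j\<in>B. \<Sum>k\<in>A. f k j a)"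
proof -
  have "(\<Sum>k\<in>A. \<Sum>j\<in>B. \<Sum>a\<in>C. f k j a) = (\<Sum>j\<in>B. \<Sum>k\<in>A. \<Sum>a\<in>C. f k j a)"
    by (rule sum.swap)
  also have "\<dots> = (\<Sum>j\<in>B. \<Sum>a\<in>C. \<Sum>k\<in>A. f k j a)"
    by (rule sum.cong[OF refl sum.swap])
  also have "\<dots> = (\<Sum>a\<in>C. \<Sum>j\<in>B. \<Sum>k\<in>A. f k j a)"
    by (rule sum.swap)
  finally show ?thesis .
qed

text \<open>Contracting an integer vector with the powers or the Horner polynomials yields, at each
  position \<open>j\<close>, an integer polynomial of degree below \<open>d\<close>. It is nonzero
  as soon as some entry at position \<open>j\<close> is, so by \<open>min\<close> its value at
  \<open>A\<close> is nonzero; this feeds \<open>generic_parameters\<close>.\<close>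

lemma scheme_from_poly_calculus:
  fixes A :: "real mat" and \<Phi> :: "int poly \<Rightarrow> real mat" and p :: "int poly"
  assumes n: "1 \<le> n" and A: "A \<in> carrier_mat n n"
    and \<Phi>: "\<And>q. \<Phi> q \<in> carrier_mat n n"
    and \<Phi>_1: "\<Phi> 1 = 1\<^sub>m n" and \<Phi>_pCons: "\<And>q. \<Phi> (pCons 0 q) = A * \<Phi> q"
    and \<Phi>_mult: "\<And>p q. \<Phi> (p * q) = \<Phi> p * \<Phi> q" and \<Phi>_add: "\<And>p q. \<Phi> (p + q) = \<Phi> p + \<Phi> q"
    and \<Phi>_smult: "\<And>c q. \<Phi> (smult c q) = of_int c \<cdot>\<^sub>m \<Phi> q"
    and p: "lead_coeff p = 1" "degree p > 0" and \<Phi>p: "\<Phi> p = 0\<^sub>m n n" and \<Phi>p': "det (\<Phi> (pderiv p)) \<noteq> 0"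
    and min: "\<And>q. q \<noteq> 0 \<Longrightarrow> degree q < degree p \<Longrightarrow> \<Phi> q \<noteq> 0\<^sub>m n n"
  shows "\<exists>s L. s > n \<and> generic_cps s n L \<and> self_similarity s n L A"
proof -
  note [simp] = carrier_matD[OF \<Phi>] carrier_matD[OF A]
  define d where "d = degree p"
  define N where "N = Suc n"
  define s where "s = d * N"
  have d: "d > 0" using p by (simp add: d_def)
  have N_sum: "{..<N} = {..n}" by (auto simp: N_def)
  define e :: "nat \<Rightarrow> int poly" where "e k = monom 1 (d - 1 - k)" for k
  define g where "g k = poly_shift (d - k) p" for k
  have \<Phi>_0: "\<Phi> 0 = 0\<^sub>m n n"
  proof -
    have "\<Phi> 0 = 0 \<cdot>\<^sub>m \<Phi> 0" using \<Phi>_smult[of 0 0] by simp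
    also have "\<dots> = 0\<^sub>m n n" by (intro eq_matI) auto
    finally show ?thesis .
  qed
  have \<Phi>_sum: "\<Phi> (\<Sum>k\<in>S. q k) $$ (i,l) = (\<Sum>k\<in>S. \<Phi> (q k) $$ (i,l))"
    if "i < n" "l < n" for S :: "nat set" and q i l
    by (induction S rule: infinite_finite_induct) (use that in \<open>auto simp: \<Phi>_0 \<Phi>_add\<close>)
  have \<Phi>_lincomb: "\<Phi> (\<Sum>k\<in>S. smult (c k) (q k)) $$ (i,l) = (\<Sum>k\<in>S. of_int (c k) * \<Phi> (q k) $$ (i,l))"
    if "i < n" "l < n" for S :: "nat set" and c q i l
    using that by (simp add: \<Phi>_sum \<Phi>_smult)
  have \<Phi>_nz: "\<exists>i<n. \<exists>l<n. \<Phi> q $$ (i,l) \<noteq> 0" if "q \<noteq> 0" "degree q < d" for q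
  proof (rule ccontr)
    assume "\<not> ?thesis"
    then have "\<Phi> q = 0\<^sub>m n n" by (intro eq_matI) auto
    then show False using min that by (simp add: d_def)
  qed
  \<comment> \<open>Integer vectors are encoded as integer lists, a countable type as the generic
    choice requires; these polynomials combine the entries at position \<open>j\<close> of all
    blocks.\<close>
  define P where "P ms j = (\<Sum>k<d. smult (ms ! (k * N + j)) (e k))" for ms :: "int list" and j
  define R where "R ms j = (\<Sum>k<d. smult (ms ! (k * N + j)) (g k))" for ms :: "int list" and j
  have coeff_P: "coeff (P ms j) (d - 1 - k) = ms ! (k * N + j)" if "k < d" for ms j k
  proof -
    have "coeff (P ms j) (d - 1 - k) = (\<Sum>k'<d. if k' = k then ms ! (k' * N + j) else 0)"
      unfolding P_def coeff_sum using that by (intro sum.cong) (auto simp: e_def)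
    then show ?thesis using that by simp
  qed
  \<comment> \<open>So \<open>g k\<close> is monic of degree \<open>k\<close>, its leading 1 being
    that of \<open>p\<close>.\<close>
  have coeff_g: "coeff (g k) i = (if i < k then coeff p (d - k + i) else if i = k then 1 else 0)" if "k < d" for k i
    using that p(1) by (auto simp: g_def coeff_poly_shift d_def add.commute coeff_eq_0)
  have P_deg: "degree (P ms j) < d" for ms j
    unfolding P_def by (intro degree_sum_less) (use d in \<open>auto simp: e_def degree_monom_eq intro: le_less_trans[OF degree_smult_le]\<close>)
  have R_deg: "degree (R ms j) < d" for ms j
    unfolding R_def
  proof (intro degree_sum_less)
    fix k assume "k \<in> {..<d}"
    then have "degree (g k) \<le> k" using coeff_g by (intro degree_le) auto
    then show "degree (smult (ms ! (k * N + j)) (g k)) < d"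
      using \<open>k \<in> {..<d}\<close> le_less_trans[OF degree_smult_le] by (metis lessThan_iff le_less_trans)
  qed (use d in simp)
  have P_nz: "\<exists>i<n. \<exists>l<n. \<Phi> (P ms j) $$ (i,l) \<noteq> 0" if "k < d" "ms ! (k * N + j) \<noteq> 0" for ms j k
  proof (rule \<Phi>_nz[OF _ P_deg])
    show "P ms j \<noteq> 0" using coeff_P[OF that(1), of ms j] that(2) by auto
  qed
  have R_nz: "\<exists>i<n. \<exists>l<n. \<Phi> (R ms j) $$ (i,l) \<noteq> 0" if "k < d" "ms ! (k * N + j) \<noteq> 0" for ms j k
  proof (rule \<Phi>_nz[OF _ R_deg])
    \<comment> \<open>The \<open>g k\<close> have distinct degrees, so the nonzero entry of largest
      block index appears unmixed as the coefficient at \<open>k0\<close>.\<close>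
    define k0 where "k0 = Max {k. k < d \<and> ms ! (k * N + j) \<noteq> 0}"
    have "k0 \<in> {k. k < d \<and> ms ! (k * N + j) \<noteq> 0}" unfolding k0_def using that by (intro Max_in) auto
    then have k0: "k0 < d" "ms ! (k0 * N + j) \<noteq> 0" by auto
    have k0_max: "ms ! (k * N + j) = 0" if "k0 < k" "k < d" for k
      using that Max_ge[of "{k. k < d \<and> ms ! (k * N + j) \<noteq> 0}" k] unfolding k0_def[symmetric] by fastforce
    have "coeff (R ms j) k0 = (\<Sum>k<d. if k = k0 then ms ! (k0 * N + j) else 0)"
      unfolding R_def coeff_sum using k0_max by (intro sum.cong) (auto simp: coeff_g not_less le_less)
    then show "R ms j \<noteq> 0" using k0 by auto
  qed
  obtain \<tau> x :: "nat \<Rightarrow> real" and U W :: "real mat" where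
    U: "U \<in> carrier_mat n N" and W: "W \<in> carrier_mat N n" and UW: "U * W = 1\<^sub>m n"
    and detW: "det (mat n n (($$) W)) \<noteq> 0"
    and \<tau>W: "\<And>l. l < n \<Longrightarrow> (\<Sum>j<N. \<tau> j * W $$ (j,l)) = 0"
    and \<tau>: "\<And>ms k. k < N \<Longrightarrow> real_of_int (ms ! k) \<noteq> 0 \<Longrightarrow> (\<Sum>j<N. real_of_int (ms ! j) * \<tau> j) \<noteq> 0"
    and UP: "\<And>ms k a l. k < N \<Longrightarrow> l < n \<Longrightarrow> \<Phi> (P ms k) $$ (a,l) \<noteq> 0 \<Longrightarrow>
      (\<Sum>j<N. \<Sum>l<n. \<Phi> (P ms j) $$ (a,l) * U $$ (l,j)) \<noteq> 0"
    and WR: "\<And>ms k a l. k < N \<Longrightarrow> l < n \<Longrightarrow> a < n \<Longrightarrow> \<Phi> (R ms k) $$ (l,a) \<noteq> 0 \<Longrightarrow>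
      (\<Sum>a<n. (\<Sum>j<N. \<Sum>l<n. W $$ (j,l) * \<Phi> (R ms j) $$ (l,a)) * x a) \<noteq> 0"
    by (rule generic_parameters[OF n, of "\<lambda>ms j. real_of_int (ms ! j)" "\<lambda>ms j a l. \<Phi> (P ms j) $$ (a,l)"
        "\<lambda>ms j l a. \<Phi> (R ms j) $$ (l,a)", folded less_Suc_eq_le, folded N_def N_sum], rule that)
  note [simp] = carrier_matD[OF U] carrier_matD[OF W]
  define F G where "F k = \<Phi> (e k) * U" and "G k = W * \<Phi> (g k)" for k
  have F[simp]: "F k \<in> carrier_mat n N" and G[simp]: "G k \<in> carrier_mat N n" for k
    using mult_carrier_mat[OF \<Phi> U] mult_carrier_mat[OF W \<Phi>] by (auto simp: F_def G_def)
  note [simp] = carrier_matD[OF F] carrier_matD[OF G]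
  define M where "M = block_row d N n F"
  define J where "J = block_col d N n G"
  define C where "C = block_scalar d N (rev_companion p)"
  have M: "M \<in> carrier_mat n s" and J: "J \<in> carrier_mat s n" and C: "C \<in> carrier_mat s s"
    by (auto simp: M_def J_def C_def s_def)
  note [simp] = carrier_matD[OF M] carrier_matD[OF J] carrier_matD[OF C]
  have F_entry: "F k $$ (i,j) = (\<Sum>l<n. \<Phi> (e k) $$ (i,l) * U $$ (l,j))" if "i < n" "j < N" for k i j
    using that by (simp add: F_def scalar_prod_def atLeast0LessThan)
  have G_entry: "G k $$ (j,i) = (\<Sum>l<n. W $$ (j,l) * \<Phi> (g k) $$ (l,i))" if "i < n" "j < N" for k i j
    using that by (simp add: G_def scalar_prod_def atLeast0LessThan)
  have \<Phi>_commute: "\<Phi> q * A = A * \<Phi> q" for q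
  proof -
    have X: "\<Phi> [:0, 1:] = A"
      using \<Phi>_pCons[of 1] unfolding \<Phi>_1 right_mult_one_mat[OF A] by (simp add: one_pCons)
    show ?thesis using \<Phi>_mult[of q "[:0, 1:]"] \<Phi>_mult[of "[:0, 1:]" q] by (simp add: X mult.commute)
  qed
  have AM: "A * M = M * C"
  proof (rule eq_matI)
    fix i c assume "i < dim_row (M * C)" "c < dim_col (M * C)"
    then have i: "i < n" and "c < d * N" by (auto simp: s_def)
    then obtain k j where kj: "k < d" "j < N" and c: "c = k * N + j" using block_index_cases by blast
    have \<Phi>e: "(A * \<Phi> (e k)) $$ (i,l) = (\<Sum>k'<d. of_int (rev_companion p k' k) * \<Phi> (e k') $$ (i,l))" if "l < n" for l
    proof -
      have "\<Phi> (if k = 0 then p else 0) = 0\<^sub>m n n" by (simp add: \<Phi>p \<Phi>_0)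
      then have "\<Phi> (pCons 0 (e k)) $$ (i,l) = \<Phi> (\<Sum>k'<d. smult (rev_companion p k' k) (e k')) $$ (i,l)"
        using rev_companion_monom[OF p(1), of k] kj(1) i that
        unfolding e_def d_def by (simp add: \<Phi>_add)
      then show ?thesis using i that by (simp add: \<Phi>_lincomb \<Phi>_pCons)
    qed
    have "(A * M) $$ (i,c) = (A * F k) $$ (i,j)"
      unfolding M_def c by (rule mult_mat_block_row[OF A F i kj])
    also have "A * F k = A * \<Phi> (e k) * U" unfolding F_def by (rule assoc_mult_mat[OF A \<Phi> U, symmetric])
    also have "\<dots> $$ (i,j) = (\<Sum>l<n. (A * \<Phi> (e k)) $$ (i,l) * U $$ (l,j))"
      using i kj(2) mult_carrier_mat[OF A \<Phi>, of "e k"]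
      by (simp add: scalar_prod_def[of _ "col U j"] atLeast0LessThan)
    also have "\<dots> = (\<Sum>l<n. \<Sum>k'<d. of_int (rev_companion p k' k) * \<Phi> (e k') $$ (i,l) * U $$ (l,j))"
      by (intro sum.cong) (simp_all add: \<Phi>e sum_distrib_right)
    also have "\<dots> = (\<Sum>k'<d. of_int (rev_companion p k' k) * F k' $$ (i,j))"
      using i kj by (subst sum.swap) (simp add: F_entry sum_distrib_left mult.assoc)
    also have "\<dots> = (M * C) $$ (i,c)"
      unfolding M_def C_def c using mult_block_row_scalar[OF i kj] by simp
    finally show "(A * M) $$ (i,c) = (M * C) $$ (i,c)" .
  qed auto
  have CJ: "C * J = J * A"
  proof (rule eq_matI)
    fix c i assume "c < dim_row (J * A)" "i < dim_col (J * A)"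
    then have i: "i < n" and "c < d * N" by (auto simp: s_def)
    then obtain k j where kj: "k < d" "j < N" and c: "c = k * N + j" using block_index_cases by blast
    have \<Phi>g: "(\<Phi> (g k) * A) $$ (l,i) = (\<Sum>k'<d. of_int (rev_companion p k k') * \<Phi> (g k') $$ (l,i))" if "l < n" for l
    proof -
      have "\<Phi> (if Suc k = d then p else 0) = 0\<^sub>m n n" by (simp add: \<Phi>p \<Phi>_0)
      moreover have "pCons 0 (g k) = (\<Sum>k'<d. smult (rev_companion p k k') (g k')) + (if Suc k = d then p else 0)"
        using rev_companion_poly_shift[OF p(1), of k] kj(1) unfolding g_def d_def by simp
      ultimately have "\<Phi> (pCons 0 (g k)) $$ (l,i) = \<Phi> (\<Sum>k'<d. smult (rev_companion p k k') (g k')) $$ (l,i)"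
        using i that by (simp add: \<Phi>_add)
      then show ?thesis using i that by (simp add: \<Phi>_lincomb \<Phi>_pCons \<Phi>_commute)
    qed
    have "(J * A) $$ (c,i) = (G k * A) $$ (j,i)"
      unfolding J_def c by (rule mult_block_col_mat[OF A G i kj])
    also have "G k * A = W * (\<Phi> (g k) * A)" unfolding G_def by (rule assoc_mult_mat[OF W \<Phi> A])
    also have "\<dots> $$ (j,i) = (\<Sum>l<n. W $$ (j,l) * (\<Phi> (g k) * A) $$ (l,i))"
      using i kj by (simp add: scalar_prod_def atLeast0LessThan)
    also have "\<dots> = (\<Sum>l<n. \<Sum>k'<d. of_int (rev_companion p k k') * (W $$ (j,l) * \<Phi> (g k') $$ (l,i)))"
      by (intro sum.cong) (simp_all add: \<Phi>g sum_distrib_left mult.left_commute)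
    also have "\<dots> = (\<Sum>k'<d. of_int (rev_companion p k k') * G k' $$ (j,i))"
      using i kj by (subst sum.swap) (simp add: G_entry sum_distrib_left)
    also have "\<dots> = (C * J) $$ (c,i)"
      unfolding J_def C_def c using mult_block_scalar_col[OF i kj] by simp
    finally show "(C * J) $$ (c,i) = (J * A) $$ (c,i)" by simp
  qed auto
  have "M * J = \<Phi> (pderiv p)"
  proof (rule eq_matI)
    fix i i' assume "i < dim_row (\<Phi> (pderiv p))" "i' < dim_col (\<Phi> (pderiv p))"
    then have ii: "i < n" "i' < n" by auto
    \<comment> \<open>\<open>U * W = 1\<close> collapses the inner factors, so the sum over blocks
      becomes the Horner formula for the derivative.\<close>
    have FG: "F k * G k = \<Phi> (e k * g k)" for k
    proof -
      have "F k * G k = \<Phi> (e k) * (U * (W * \<Phi> (g k)))"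
        unfolding F_def G_def by (rule assoc_mult_mat[OF \<Phi> U mult_carrier_mat[OF W \<Phi>]])
      also have "U * (W * \<Phi> (g k)) = U * W * \<Phi> (g k)" by (rule assoc_mult_mat[OF U W \<Phi>, symmetric])
      finally show ?thesis using left_mult_one_mat[OF \<Phi>] by (simp add: UW \<Phi>_mult)
    qed
    have "(M * J) $$ (i,i') = (\<Sum>k<d. (F k * G k) $$ (i,i'))"
      unfolding M_def J_def by (rule mult_block_row_col) (use ii in auto)
    also have "\<dots> = \<Phi> (\<Sum>k<d. e k * g k) $$ (i,i')" using ii by (simp add: FG \<Phi>_sum)
    also have "(\<Sum>k<d. e k * g k) = pderiv p"
      unfolding e_def g_def d_def by (rule pderiv_eq_sum_poly_shift)
    finally show "(M * J) $$ (i,i') = \<Phi> (pderiv p) $$ (i,i')" .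
  qed auto
  then have detMJ: "det (M * J) \<noteq> 0" using \<Phi>p' by simp
  \<comment> \<open>Hence block 0 of \<open>J\<close> is \<open>W\<close>, and the top square part
    of \<open>J\<close> is the invertible one of \<open>W\<close>.\<close>
  have "g 0 = 1" using d by (intro poly_eqI) (simp add: coeff_g)
  then have "G 0 = W" using right_mult_one_mat[OF W] by (simp add: G_def \<Phi>_1)
  then have "J $$ (i,l) = W $$ (i,l)" if "i < n" "l < n" for i l
    using block_index(2)[OF d, of i N l n G] that by (simp add: J_def N_def)
  then have "mat n n (($$) J) = mat n n (($$) W)" by (intro eq_matI) auto
  then have detJ: "det (mat n n (($$) J)) \<noteq> 0" using detW by simp
  have int_vec_list: "\<exists>ms. \<forall>c<s. r $ c = of_int (ms ! c)" if "r \<in> int_vecs s" for r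
    using that by (intro exI[of _ "map (\<lambda>c. \<lfloor>r $ c\<rfloor>) [0..<s]"]) (auto simp: int_vecs_def Ints_def)
  have C_int: "C $$ (i,j) \<in> \<int>" if "i < s" "j < s" for i j
    using that by (auto simp: C_def block_scalar_def s_def)
  have M_inj: "r = 0\<^sub>v s" if r: "r \<in> int_vecs s" and Mr: "M *\<^sub>v r = 0\<^sub>v n" for r
  proof (rule ccontr)
    assume "r \<noteq> 0\<^sub>v s"
    have rc: "r \<in> carrier_vec s" using r by (simp add: int_vecs_def)
    obtain ms where ms: "\<And>c. c < s \<Longrightarrow> r $ c = of_int (ms ! c)" using int_vec_list[OF r] by blast
    have "\<exists>c<s. r $ c \<noteq> 0" using rc \<open>r \<noteq> 0\<^sub>v s\<close> by (metis eq_vecI carrier_vecD index_zero_vec)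
    then obtain k j where kj: "k < d" "j < N" "ms ! (k * N + j) \<noteq> 0"
      using ms block_index_cases unfolding s_def by (metis of_int_0)
    obtain a l where al: "a < n" "l < n" "\<Phi> (P ms j) $$ (a,l) \<noteq> 0" using P_nz[OF kj(1,3)] by blast
    \<comment> \<open>Regrouping by position turns row \<open>a\<close> of \<open>M r\<close> into
      the form in \<open>U\<close> with coefficients from \<open>\<Phi> (P ms j)\<close>.\<close>
    have "(M *\<^sub>v r) $ a = (\<Sum>k<d. \<Sum>j<N. F k $$ (a,j) * of_int (ms ! (k * N + j)))"
      using al rc ms by (simp add: scalar_prod_def atLeast0LessThan sum_block M_def s_def block_index_less)
    also have "\<dots> = (\<Sum>j<N. \<Sum>k<d. \<Sum>l<n. of_int (ms ! (k * N + j)) * \<Phi> (e k) $$ (a,l) * U $$ (l,j))"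
      using al by (subst sum.swap) (simp add: F_entry sum_distrib_right sum_distrib_left algebra_simps)
    also have "\<dots> = (\<Sum>j<N. \<Sum>l<n. \<Phi> (P ms j) $$ (a,l) * U $$ (l,j))"
    proof (rule sum.cong)
      fix j
      have "(\<Sum>k<d. \<Sum>l<n. of_int (ms ! (k * N + j)) * \<Phi> (e k) $$ (a,l) * U $$ (l,j))
          = (\<Sum>l<n. \<Sum>k<d. of_int (ms ! (k * N + j)) * \<Phi> (e k) $$ (a,l) * U $$ (l,j))"
        by (rule sum.swap)
      then show "(\<Sum>k<d. \<Sum>l<n. of_int (ms ! (k * N + j)) * \<Phi> (e k) $$ (a,l) * U $$ (l,j))
          = (\<Sum>l<n. \<Phi> (P ms j) $$ (a,l) * U $$ (l,j))"
        using al by (simp add: P_def \<Phi>_lincomb sum_distrib_right)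
    qed simp
    finally show False using UP[OF kj(2) al(2,3)] Mr al by simp
  qed
  have J_int: "J *\<^sub>v y = 0\<^sub>v s" if y: "y \<in> carrier_vec n" and r: "J *\<^sub>v y \<in> int_vecs s" for y
  proof (rule eq_vecI)
    fix c assume "c < dim_vec (0\<^sub>v s :: real vec)"
    then have "c < d * N" by (simp add: s_def)
    then obtain k j where kj: "k < d" "j < N" and c: "c = k * N + j" using block_index_cases by blast
    obtain ms where ms: "\<And>c. c < s \<Longrightarrow> (J *\<^sub>v y) $ c = of_int (ms ! c)" using int_vec_list[OF r] by blast
    have idx: "k * N + j' < s" if "j' < N" for j' using block_index_less[OF kj(1) that] by (simp add: s_def)
    \<comment> \<open>Block \<open>k\<close> of \<open>J y\<close> is \<open>W u\<close>, hence
      orthogonal to \<open>\<tau>\<close>. The entries of \<open>\<tau>\<close> are rationally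
      independent, so an integer block must be zero.\<close>
    define u where "u l = (\<Sum>i<n. \<Phi> (g k) $$ (l,i) * y $ i)" for l
    have Jy: "(J *\<^sub>v y) $ (k * N + j') = (\<Sum>l<n. W $$ (j',l) * u l)" if "j' < N" for j'
    proof -
      have "(J *\<^sub>v y) $ (k * N + j') = (\<Sum>i<n. G k $$ (j',i) * y $ i)"
        using idx[OF that] that y kj by (simp add: scalar_prod_def atLeast0LessThan J_def s_def)
      also have "\<dots> = (\<Sum>i<n. \<Sum>l<n. W $$ (j',l) * (\<Phi> (g k) $$ (l,i) * y $ i))"
        using that by (intro sum.cong) (auto simp: G_entry sum_distrib_right mult.assoc)
      also have "\<dots> = (\<Sum>l<n. W $$ (j',l) * u l)"
        unfolding u_def by (subst sum.swap) (simp add: sum_distrib_left)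
      finally show ?thesis .
    qed
    define zs where "zs = map (\<lambda>j'. ms ! (k * N + j')) [0..<N]"
    have zs: "real_of_int (zs ! j') = (J *\<^sub>v y) $ (k * N + j')" if "j' < N" for j'
      using that ms[OF idx[OF that]] by (simp add: zs_def)
    have "(\<Sum>j'<N. real_of_int (zs ! j') * \<tau> j')
        = (\<Sum>j'<N. \<Sum>l<n. \<tau> j' * W $$ (j',l) * u l)"
    proof (rule sum.cong)
      fix j' assume "j' \<in> {..<N}"
      then have j': "j' < N" by simp
      show "real_of_int (zs ! j') * \<tau> j' = (\<Sum>l<n. \<tau> j' * W $$ (j',l) * u l)"
        by (simp only: zs[OF j'] Jy[OF j']) (simp add: sum_distrib_left sum_distrib_right mult_ac)
    qed simp
    also have "\<dots> = (\<Sum>l<n. (\<Sum>j'<N. \<tau> j' * W $$ (j',l)) * u l)"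
      by (subst sum.swap) (simp add: sum_distrib_right)
    also have "\<dots> = 0" by (simp add: \<tau>W)
    finally have "real_of_int (zs ! j) = 0" using \<tau>[OF kj(2), of zs] by blast
    then show "(J *\<^sub>v y) $ c = 0\<^sub>v s $ c" using zs[OF kj(2)] idx[OF kj(2)] c by simp
  qed simp
  define xv where "xv = vec n x"
  have xv: "xv \<in> carrier_vec n" by (simp add: xv_def)
  have indep: "r = 0\<^sub>v s" if r: "r \<in> int_vecs s" and rJ: "r \<bullet> (J *\<^sub>v xv) = 0" for r
  proof (rule ccontr)
    assume "r \<noteq> 0\<^sub>v s"
    have rc: "r \<in> carrier_vec s" using r by (simp add: int_vecs_def)
    obtain ms where ms: "\<And>c. c < s \<Longrightarrow> r $ c = of_int (ms ! c)" using int_vec_list[OF r] by blast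
    have "\<exists>c<s. r $ c \<noteq> 0" using rc \<open>r \<noteq> 0\<^sub>v s\<close> by (metis eq_vecI carrier_vecD index_zero_vec)
    then obtain k j where kj: "k < d" "j < N" "ms ! (k * N + j) \<noteq> 0"
      using ms block_index_cases unfolding s_def by (metis of_int_0)
    obtain l a where al: "l < n" "a < n" "\<Phi> (R ms j) $$ (l,a) \<noteq> 0" using R_nz[OF kj(1,3)] by blast
    \<comment> \<open>Regrouping by the coordinates of \<open>x\<close> gives the form that the
      choice of \<open>W\<close> and \<open>x\<close> keeps nonzero.\<close>
    have "r \<bullet> (J *\<^sub>v xv) = (\<Sum>k<d. \<Sum>j<N. of_int (ms ! (k * N + j)) * (\<Sum>a<n. G k $$ (j,a) * x a))"
      using rc ms by (simp add: scalar_prod_def atLeast0LessThan sum_block J_def s_def block_index_less xv_def)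
    also have "\<dots> = (\<Sum>k<d. \<Sum>j<N. \<Sum>a<n. of_int (ms ! (k * N + j)) * G k $$ (j,a) * x a)"
      by (simp add: sum_distrib_left mult.assoc)
    also have "\<dots> = (\<Sum>a<n. \<Sum>j<N. \<Sum>k<d. of_int (ms ! (k * N + j)) * G k $$ (j,a) * x a)"
      by (rule sum_swap_outer)
    also have "\<dots> = (\<Sum>a<n. (\<Sum>j<N. \<Sum>k<d. of_int (ms ! (k * N + j)) * G k $$ (j,a)) * x a)"
      by (simp add: sum_distrib_right)
    also have "\<dots> = (\<Sum>a<n. (\<Sum>j<N. \<Sum>l<n. W $$ (j,l) * \<Phi> (R ms j) $$ (l,a)) * x a)"
    proof -
      have "(\<Sum>k<d. of_int (ms ! (k * N + j)) * G k $$ (j,a)) = (\<Sum>l<n. W $$ (j,l) * \<Phi> (R ms j) $$ (l,a))"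
        if aj: "a < n" "j < N" for a j
      proof -
        have "(\<Sum>k<d. of_int (ms ! (k * N + j)) * G k $$ (j,a))
            = (\<Sum>k<d. \<Sum>l<n. W $$ (j,l) * (of_int (ms ! (k * N + j)) * \<Phi> (g k) $$ (l,a)))"
          using aj by (simp add: G_entry sum_distrib_left mult.left_commute)
        also have "\<dots> = (\<Sum>l<n. W $$ (j,l) * \<Phi> (R ms j) $$ (l,a))"
          using aj by (subst sum.swap) (simp add: R_def \<Phi>_lincomb sum_distrib_left)
        finally show ?thesis .
      qed
      then show ?thesis by simp
    qed
    finally show False using WR[OF kj(2) al] rJ by simp
  qed
  have "N \<le> d * N" using d by simp
  then have "n < s" by (simp add: s_def N_def)
  moreover have "\<exists>L. generic_cps s n L \<and> self_similarity s n L A"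
    by (rule generic_scheme_exists[OF n \<open>n < s\<close> A M J C C_int AM CJ detMJ detJ M_inj J_int xv indep])
  ultimately show ?thesis by blast
qed

section \<open>The characterization\<close>

text \<open>Conjugation by \<open>L\<close> equates the characteristic polynomial of
  \<open>diag(A, B)\<close> with that of the integer matrix \<open>C\<close>. Padding an eigenvector
  of \<open>A\<close> with zeros makes its eigenvalue a root of it.\<close>

lemma self_similarity_imp_algebraic_int:
  assumes "self_similarity s n L A" and "cut_and_project s n L"
    and ev: "eigenvalue (map_mat complex_of_real A) ev"
  shows "algebraic_int ev"
proof -
  define m where "m = s - n"
  have s: "s = n + m" using assms(2) by (simp add: m_def cut_and_project_def)
  have L: "L \<in> carrier_mat s s" "det L \<noteq> 0" using assms(2) by (auto simp: cut_and_project_def)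
  obtain C B where A: "A \<in> carrier_mat n n" and C: "C \<in> carrier_mat s s" "\<And>i j. i < s \<Longrightarrow> j < s \<Longrightarrow> C $$ (i,j) \<in> \<int>"
    and B: "B \<in> carrier_mat m m"
    and FL: "four_block_mat A (0\<^sub>m n m) (0\<^sub>m m n) B * L = L * C"
    using assms(1) by (auto simp: self_similarity_def m_def)
  define F where "F = four_block_mat A (0\<^sub>m n m) (0\<^sub>m m n) B"
  have F: "F \<in> carrier_mat s s" using A B by (simp add: F_def s)
  obtain Y where Y: "Y \<in> carrier_mat s s" "L * Y = 1\<^sub>m s" "Y * L = 1\<^sub>m s"
    using det_nonzero_inverse[OF L] by metis
  have "F = F * (L * Y)" using F by (simp add: Y)
  also have "\<dots> = L * C * Y" using assoc_mult_mat[OF F L(1) Y(1)] FL by (simp add: F_def)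
  finally have "similar_mat_wit F C L Y"
    using F C L Y by (intro similar_mat_witI[of _ _ s]) auto
  then have cp: "char_poly F = char_poly C"
    by (intro char_poly_similar) (auto simp: similar_mat_def)
  \<comment> \<open>The entries of \<open>C\<close> are integers of type \<open>real\<close>, so
    \<open>floor\<close> moves them to type \<open>int\<close> without loss.\<close>
  define Ci where "Ci = map_mat floor C"
  have Ci: "Ci \<in> carrier_mat s s" "C = map_mat real_of_int Ci"
    using C by (auto simp: Ci_def intro!: eq_matI)
  have "char_poly C = of_int_poly (char_poly Ci)"
    unfolding Ci(2) by (rule of_int_hom.char_poly_hom[OF Ci(1)])
  then have cpF: "char_poly (map_mat complex_of_real F) = of_int_poly (char_poly Ci)"
    by (simp add: of_real_hom.char_poly_hom[OF F] cp map_poly_map_poly o_def)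
  obtain v where v: "v \<in> carrier_vec n" "v \<noteq> 0\<^sub>v n" "map_mat complex_of_real A *\<^sub>v v = ev \<cdot>\<^sub>v v"
    using ev A by (auto simp: eigenvalue_def eigenvector_def)
  have blockF: "map_mat complex_of_real F
      = four_block_mat (map_mat complex_of_real A) (0\<^sub>m n m) (0\<^sub>m m n) (map_mat complex_of_real B)"
    using A B by (auto simp: F_def intro!: eq_matI)
  have "map_mat complex_of_real F *\<^sub>v (v @\<^sub>v 0\<^sub>v m) = ev \<cdot>\<^sub>v (v @\<^sub>v 0\<^sub>v m)"
  proof -
    have "map_mat complex_of_real F *\<^sub>v (v @\<^sub>v 0\<^sub>v m)
        = map_mat complex_of_real A *\<^sub>v v @\<^sub>v map_mat complex_of_real B *\<^sub>v 0\<^sub>v m"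
      unfolding blockF by (rule mult_mat_vec_split) (use A B v in auto)
    also have "\<dots> = ev \<cdot>\<^sub>v (v @\<^sub>v 0\<^sub>v m)"
    proof -
      have "map_mat complex_of_real B *\<^sub>v 0\<^sub>v m = 0\<^sub>v m"
        using B by (intro eq_vecI) (auto simp: scalar_prod_def)
      then show ?thesis unfolding v(3) by (intro eq_vecI) auto
    qed
    finally show ?thesis .
  qed
  moreover have "v @\<^sub>v 0\<^sub>v m \<noteq> 0\<^sub>v s"
  proof
    assume "v @\<^sub>v 0\<^sub>v m = 0\<^sub>v s"
    then have "(v @\<^sub>v 0\<^sub>v m) $ i = 0" if "i < n" for i using that by (simp add: s)
    then have "v $ i = 0" if "i < n" for i using v(1) that by (metis carrier_vecD index_append_vec(1) trans_less_add1)
    then show False using v(1,2) by (metis eq_vecI carrier_vecD index_zero_vec)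
  qed
  ultimately have "eigenvalue (map_mat complex_of_real F) ev"
    using F v(1) by (auto simp: eigenvalue_def eigenvector_def s intro!: exI[of _ "v @\<^sub>v 0\<^sub>v m"])
  then have "poly (of_int_poly (char_poly Ci)) ev = 0"
    using eigenvalue_root_char_poly[of "map_mat complex_of_real F" s] F cpF by simp
  then show ?thesis
    using degree_monic_char_poly[OF Ci(1)] by (auto simp: algebraic_int_altdef_ipoly)
qed

theorem theorem2:
  fixes n :: nat and A :: "real mat"
  assumes "1 \<le> n"
    and "A \<in> carrier_mat n n"
    and "diagonalizable_over_C n A"
  shows "(\<exists>s L. s > n \<and> generic_cps s n L \<and> self_similarity s n L A) \<longleftrightarrow>
         (\<forall>ev. eigenvalue (map_mat complex_of_real A) ev \<longrightarrow> algebraic_int ev)"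
proof
  assume "\<exists>s L. s > n \<and> generic_cps s n L \<and> self_similarity s n L A"
  then show "\<forall>ev. eigenvalue (map_mat complex_of_real A) ev \<longrightarrow> algebraic_int ev"
    using self_similarity_imp_algebraic_int by (auto simp: generic_cps_def)
next
  assume ints: "\<forall>ev. eigenvalue (map_mat complex_of_real A) ev \<longrightarrow> algebraic_int ev"
  obtain lam \<Phi> where lam: "\<And>l. l < n \<Longrightarrow> eigenvalue (map_mat complex_of_real A) (lam l)"
    and \<Phi>: "\<And>q. \<Phi> q \<in> carrier_mat n n"
      "\<Phi> 1 = 1\<^sub>m n" "\<And>q. \<Phi> (pCons 0 q) = A * \<Phi> q"
      "\<And>p q. \<Phi> (p * q) = \<Phi> p * \<Phi> q" "\<And>p q. \<Phi> (p + q) = \<Phi> p + \<Phi> q"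
      "\<And>c q. \<Phi> (smult c q) = of_int c \<cdot>\<^sub>m \<Phi> q"
    and \<Phi>_0: "\<And>q. \<Phi> q = 0\<^sub>m n n \<longleftrightarrow> (\<forall>l<n. poly (of_int_poly q) (lam l) = 0)"
    and \<Phi>_det: "\<And>q. (\<And>l. l < n \<Longrightarrow> poly (of_int_poly q) (lam l) \<noteq> 0) \<Longrightarrow> det (\<Phi> q) \<noteq> 0"
    using diagonalizable_poly_calculus[OF assms(2,3)] by blast
  obtain p :: "int poly" where p: "lead_coeff p = 1" "degree p > 0"
    and root: "\<And>x. x \<in> lam ` {..<n} \<Longrightarrow> poly (of_int_poly p) x = 0"
    and min: "\<And>r :: int poly. r \<noteq> 0 \<Longrightarrow> degree r < degree p \<Longrightarrow> \<exists>x\<in>lam ` {..<n}. poly (of_int_poly r) x \<noteq> 0"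
    and simple: "\<And>x. x \<in> lam ` {..<n} \<Longrightarrow> poly (of_int_poly (pderiv p)) x \<noteq> 0"
  proof (rule minimal_monic_int_poly[of "lam ` {..<n}"])
    \<comment> \<open>\<open>1 \<le> n\<close> provides an eigenvalue, which keeps the minimal
      polynomial from being constant.\<close>
    have "lam 0 \<in> lam ` {..<n}" using assms(1) by simp
    then show "lam ` {..<n} \<noteq> {}" by blast
  qed (use lam ints in auto)
  show "\<exists>s L. s > n \<and> generic_cps s n L \<and> self_similarity s n L A"
  proof (rule scheme_from_poly_calculus[OF assms(1,2) \<Phi> p])
    show "\<Phi> p = 0\<^sub>m n n" using root by (auto simp: \<Phi>_0)
    show "det (\<Phi> (pderiv p)) \<noteq> 0" using simple by (intro \<Phi>_det) auto
    show "\<Phi> q \<noteq> 0\<^sub>m n n" if "q \<noteq> 0" "degree q < degree p" for q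
      using min[OF that] by (auto simp: \<Phi>_0)
  qed
qed

end
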